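(* Fix $\theta\in(0,\pi/4]$ and let the Bank distribute $|\Phi\rangle_{A'B'K}=\alpha|000\rangle+\beta|111\rangle$ with real $\alpha\ge\beta>0$, $\alpha^2+\beta^2=1$, in addition to the link $|\psi(\theta)\rangle_{AB}=\cos\theta|00\rangle+\sin\theta|11\rangle$ shared by Alice and Bob. In the Bank-measures model (the Bank measures $K$ and broadcasts one bit), Alice and Bob can deterministically restore a perfect Bell pair on $AB$ by LOCC if and only if $$\alpha^2\le\frac{1}{2\cos^2\theta}.$$ The same feasibility condition holds in the transfer model, in which $K$ is moved to Alice.
   Context: All registers $A,B,A',B',K$ are qubits. The global initial state is $|\psi(\theta)\rangle_{AB}\otimes|\Phi\rangle_{A'B'K}$. Alice holds $A,A'$; Bob holds $B,B'$; the Bank holds $K$. LOCC means local quantum operations by Alice and Bob (local ancillas and discarding of systems allowed) with finitely many rounds of classical communication between them. Bank-measures model: the Bank performs a quantum measurement on $K$ (of its choice) and broadcasts the classical outcome; afterwards Alice (on $AA'$) and Bob (on $BB'$) act by LOCC, which may depend on the outcome; the Bank does nothing else. Transfer model: the Bank hands $K$ to Alice and is then absent; Alice (holding $AA'K$) and Bob (holding $BB'$) act by LOCC. Deterministic restoration of a perfect Bell pair on $AB$ means that, with probability one, the final state of the registers $A$ and $B$ is exactly $|\Phi^+\rangle=\frac{1}{\sqrt2}(|00\rangle+|11\rangle)$; other registers may be left in any state or discarded. *)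

theory Defs
  imports Complex_Main "Jordan_Normal_Form.Schur_Decomposition"
begin

text \<open>
  Finite-dimensional systems are represented by their dimension, pure states by vectors and
  (unnormalised) density operators by square complex matrices. In a composite system the leftmost
  factor is the most significant part of the index: basis vector \<open>x \<otimes> y\<close> of a system of
  dimensions \<open>m\<close> and \<open>n\<close> has index \<open>x * n + y\<close>.
\<close>

definition kron_vec :: "complex vec \<Rightarrow> complex vec \<Rightarrow> complex vec" where
  "kron_vec u v = vec (dim_vec u * dim_vec v) (\<lambda>i. u $ (i div dim_vec v) * v $ (i mod dim_vec v))"

definition kron :: "complex mat \<Rightarrow> complex mat \<Rightarrow> complex mat" where
  "kron M N = mat (dim_row M * dim_row N) (dim_col M * dim_col N)
     (\<lambda>(i, j). M $$ (i div dim_row N, j div dim_col N) * N $$ (i mod dim_row N, j mod dim_col N))"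

definition proj :: "complex vec \<Rightarrow> complex mat" where
  "proj v = mat (dim_vec v) (dim_vec v) (\<lambda>(i, j). v $ i * cnj (v $ j))"

definition mtrace :: "complex mat \<Rightarrow> complex" where
  "mtrace M = (\<Sum>i<dim_row M. M $$ (i, i))"


subsection \<open>Local operations\<close>

text \<open>
  A local operation with a classical outcome is a quantum instrument with finitely many outcomes.
  Outcome number \<open>i\<close> is given by the dimension of the system that the party holds afterwards and
  by a list of Kraus operators. As the output dimension is arbitrary and there may be several Kraus
  operators per outcome, this includes attaching ancillas, discarding subsystems and forgetting
  measurement results.
\<close>

type_synonym instr = "(nat \<times> complex mat list) list"

definition is_instr :: "nat \<Rightarrow> instr \<Rightarrow> bool" where
  "is_instr d I \<longleftrightarrow>
     (\<forall>(e, Ks) \<in> set I. 0 < e \<and> set Ks \<subseteq> carrier_mat e d) \<and>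
     mat d d (\<lambda>ij. \<Sum>(e, Ks) \<leftarrow> I. \<Sum>M \<leftarrow> Ks. (mat_adjoint M * M) $$ ij) = 1\<^sub>m d"

definition out_dim :: "instr \<Rightarrow> nat \<Rightarrow> nat" where
  "out_dim I i = fst (I ! i)"

definition kraus_ops :: "instr \<Rightarrow> nat \<Rightarrow> complex mat list" where
  "kraus_ops I i = snd (I ! i)"

text \<open>The first argument is the output dimension; the result is not normalised.\<close>

definition apply_kraus :: "nat \<Rightarrow> complex mat list \<Rightarrow> complex mat \<Rightarrow> complex mat" where
  "apply_kraus n Ms \<rho> = mat n n (\<lambda>ij. \<Sum>M \<leftarrow> Ms. (M * \<rho> * mat_adjoint M) $$ ij)"


subsection \<open>LOCC protocols\<close>

text \<open>
  A protocol either stops, or lets one party perform an instrument on everything that party holds,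
  announce the outcome \<open>i\<close>, and continue with the protocol given for \<open>i\<close>. Only the finitely many
  continuations with \<open>i < length I\<close> are relevant, so the number of rounds is bounded.
\<close>

datatype locc =
    Stop
  | Alice instr "nat \<Rightarrow> locc"
  | Bob instr "nat \<Rightarrow> locc"

text \<open>
  \<open>valid P dA dB\<close>: \<open>P\<close> can be run on systems of dimension \<open>dA\<close> (Alice) and \<open>dB\<close> (Bob), and
  it ends with Alice holding the qubit \<open>A\<close> and Bob the qubit \<open>B\<close>, each as the leftmost factor of
  the party's system, next to a remainder of arbitrary dimension.
\<close>

primrec valid :: "locc \<Rightarrow> nat \<Rightarrow> nat \<Rightarrow> bool" where
  "valid Stop dA dB \<longleftrightarrow> even dA \<and> even dB"
| "valid (Alice I P) dA dB \<longleftrightarrow>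
     is_instr dA I \<and> (\<forall>i<length I. valid (P i) (out_dim I i) dB)"
| "valid (Bob I P) dA dB \<longleftrightarrow>
     is_instr dB I \<and> (\<forall>i<length I. valid (P i) dA (out_dim I i))"

text \<open>
  All ways in which a protocol can end, each with Alice's and Bob's final dimensions and the
  unnormalised final state, whose trace is the probability of that branch.
\<close>

primrec final_branches ::
  "locc \<Rightarrow> nat \<Rightarrow> nat \<Rightarrow> complex mat \<Rightarrow> (nat \<times> nat \<times> complex mat) set" where
  "final_branches Stop dA dB \<rho> = {(dA, dB, \<rho>)}"
| "final_branches (Alice I P) dA dB \<rho> =
     (\<Union>i<length I. final_branches (P i) (out_dim I i) dB
        (apply_kraus (out_dim I i * dB) (map (\<lambda>M. kron M (1\<^sub>m dB)) (kraus_ops I i)) \<rho>))"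
| "final_branches (Bob I P) dA dB \<rho> =
     (\<Union>i<length I. final_branches (P i) dA (out_dim I i)
        (apply_kraus (dA * out_dim I i) (map (\<lambda>M. kron (1\<^sub>m dA) M) (kraus_ops I i)) \<rho>))"


subsection \<open>Restoration of a Bell pair\<close>

definition bell :: "complex vec" where
  "bell = vec_of_list [1 / sqrt 2, 0, 0, 1 / sqrt 2]"

text \<open>
  Partial trace of a state of \<open>A R\<^sub>A B R\<^sub>B\<close> (with \<open>R\<^sub>A\<close>, \<open>R\<^sub>B\<close> of dimensions \<open>r\<close>, \<open>s\<close>)
  over \<open>R\<^sub>A\<close> and \<open>R\<^sub>B\<close>.
\<close>

definition reduce_AB :: "nat \<Rightarrow> nat \<Rightarrow> complex mat \<Rightarrow> complex mat" where
  "reduce_AB r s \<rho> = mat 4 4 (\<lambda>(i, j). \<Sum>x<r. \<Sum>y<s.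
     \<rho> $$ (((i div 2) * r + x) * (2 * s) + ((i mod 2) * s + y),
           ((j div 2) * r + x) * (2 * s) + ((j mod 2) * s + y)))"

text \<open>
  Every branch that occurs with nonzero probability ends with \<open>AB\<close> exactly in the Bell state.
\<close>

definition restores_bell :: "locc \<Rightarrow> nat \<Rightarrow> nat \<Rightarrow> complex mat \<Rightarrow> bool" where
  "restores_bell P dA dB \<rho> \<longleftrightarrow> valid P dA dB \<and>
     (\<forall>(eA, eB, \<sigma>) \<in> final_branches P dA dB \<rho>.
        mtrace \<sigma> \<noteq> 0 \<longrightarrow>
        (1 / mtrace \<sigma>) \<cdot>\<^sub>m reduce_AB (eA div 2) (eB div 2) \<sigma> = proj bell)"


subsection \<open>The initial state\<close>

definition link :: "real \<Rightarrow> complex vec" where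
  "link \<theta> = vec_of_list [of_real (cos \<theta>), 0, 0, of_real (sin \<theta>)]"

definition ghz :: "real \<Rightarrow> real \<Rightarrow> complex vec" where
  "ghz \<alpha> \<beta> = vec_of_list [of_real \<alpha>, 0, 0, 0, 0, 0, 0, of_real \<beta>]"

text \<open>Registers in the order \<open>A B A' B' K\<close>.\<close>

definition initial :: "real \<Rightarrow> real \<Rightarrow> real \<Rightarrow> complex vec" where
  "initial \<theta> \<alpha> \<beta> = kron_vec (link \<theta>) (ghz \<alpha> \<beta>)"

definition amplitude ::
  "real \<Rightarrow> real \<Rightarrow> real \<Rightarrow> nat \<Rightarrow> nat \<Rightarrow> nat \<Rightarrow> nat \<Rightarrow> nat \<Rightarrow> complex" where
  "amplitude \<theta> \<alpha> \<beta> a b a' b' k = initial \<theta> \<alpha> \<beta> $ (16 * a + 8 * b + 4 * a' + 2 * b' + k)"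

text \<open>
  The initial state with the registers regrouped by owner: \<open>K\<close>, \<open>A A'\<close>, \<open>B B'\<close> when the Bank keeps
  \<open>K\<close>, and \<open>A A' K\<close>, \<open>B B'\<close> when \<open>K\<close> is handed to Alice.
\<close>

definition initial_KAB :: "real \<Rightarrow> real \<Rightarrow> real \<Rightarrow> complex vec" where
  "initial_KAB \<theta> \<alpha> \<beta> = vec 32 (\<lambda>i.
     let k = i div 16; a = i div 8 mod 2; a' = i div 4 mod 2; b = i div 2 mod 2; b' = i mod 2
     in amplitude \<theta> \<alpha> \<beta> a b a' b' k)"

definition initial_transfer :: "real \<Rightarrow> real \<Rightarrow> real \<Rightarrow> complex vec" where
  "initial_transfer \<theta> \<alpha> \<beta> = vec 32 (\<lambda>i.
     let a = i div 16; a' = i div 8 mod 2; k = i div 4 mod 2; b = i div 2 mod 2; b' = i mod 2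
     in amplitude \<theta> \<alpha> \<beta> a b a' b' k)"


subsection \<open>The two models\<close>

text \<open>
  Partial trace over the leftmost factor of a bipartite system of dimensions \<open>e\<close>, \<open>n\<close>.
\<close>

definition trace_left :: "nat \<Rightarrow> nat \<Rightarrow> complex mat \<Rightarrow> complex mat" where
  "trace_left e n \<rho> = mat n n (\<lambda>(i, j). \<Sum>k<e. \<rho> $$ (k * n + i, k * n + j))"

text \<open>
  The unnormalised state of \<open>A A' B B'\<close> after the Bank's measurement has yielded outcome \<open>i\<close>.
  The Bank's post-measurement system is traced out, as the Bank does not act again.
\<close>

definition after_bank :: "real \<Rightarrow> real \<Rightarrow> real \<Rightarrow> instr \<Rightarrow> nat \<Rightarrow> complex mat" where
  "after_bank \<theta> \<alpha> \<beta> I i = trace_left (out_dim I i) 16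
     (apply_kraus (out_dim I i * 16) (map (\<lambda>M. kron M (1\<^sub>m 16)) (kraus_ops I i))
        (proj (initial_KAB \<theta> \<alpha> \<beta>)))"

text \<open>\<open>m\<close> is the number of classical messages the Bank can broadcast (\<open>m = 2\<close> for one bit).\<close>

definition bank_measures_feasible :: "nat \<Rightarrow> real \<Rightarrow> real \<Rightarrow> real \<Rightarrow> bool" where
  "bank_measures_feasible m \<theta> \<alpha> \<beta> \<longleftrightarrow>
     (\<exists>I. is_instr 2 I \<and> length I = m \<and>
        (\<forall>i<m. \<exists>P. restores_bell P 4 4 (after_bank \<theta> \<alpha> \<beta> I i)))"

definition transfer_feasible :: "real \<Rightarrow> real \<Rightarrow> real \<Rightarrow> bool" where
  "transfer_feasible \<theta> \<alpha> \<beta> \<longleftrightarrow>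
     (\<exists>P. restores_bell P 8 4 (proj (initial_transfer \<theta> \<alpha> \<beta>)))"

end

theory Submission
  imports Defs "HOL-Analysis.L2_Norm"
begin

text \<open>
  Necessity. Write a pure state of Alice and Bob as a coefficient matrix \<open>\<Psi>\<close> and call it
  half-bounded if its squared overlap with every normalised product vector is at most half of its squared
  norm, i.e. if its largest squared Schmidt coefficient is at most \<open>1/2\<close>. Every state of the form
  Bell pair times rest is half-bounded, and if all the states \<open>K \<Psi>\<close> that arise from \<open>\<Psi>\<close> under a local
  measurement are half-bounded then so is \<open>\<Psi>\<close>. Running a successful protocol backwards,
  the initial state is half-bounded, and its squared overlap with \<open>|00...0\<rangle>\<close> is \<open>\<alpha>\<^sup>2 cos\<^sup>2 \<theta>\<close>. When the Bank
  measures, the same inequality for each of its branches is summed over the branches.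

  Sufficiency. With squared Schmidt coefficients \<open>l\<^sub>0, ..., l\<^sub>3\<close>, \<open>l\<^sub>0 \<le> 1/2\<close>, one writes \<open>l\<close> as a
  combination \<open>\<Sum> w\<^sub>p\<^sub>q (e\<^sub>p + e\<^sub>q)\<close> with nonnegative weights. Alice measures with the Kraus operators
  \<open>\<Sum>\<^sub>r\<^sub>\<in>\<^sub>{\<^sub>p\<^sub>,\<^sub>q\<^sub>} \<surd>(w\<^sub>p\<^sub>q / l\<^sub>r) |r\<rangle>\<langle>r|\<close>, which leaves a Bell pair on the span of \<open>p\<close> and \<open>q\<close>. The Bank
  measures \<open>K\<close> in the Hadamard basis, which only changes signs of the Schmidt coefficients.
\<close>

subsection \<open>Ensembles of pure states\<close>

lemma adjoint_eq:
  "mat_adjoint M = mat (dim_col M) (dim_row M) (\<lambda>(i, j). cnj (M $$ (j, i)))"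
  by (rule eq_matI) (auto simp: mat_adjoint_def mat_of_rows_def)

lemma adjoint_dim [simp]:
  "dim_row (mat_adjoint M) = dim_col (M :: complex mat)"
  "dim_col (mat_adjoint M) = dim_row (M :: complex mat)"
  by (simp_all add: adjoint_eq)

lemma sum_div_mod:
  fixes g :: "nat \<Rightarrow> nat \<Rightarrow> 'a::comm_monoid_add"
  shows "(\<Sum>l<m * n. g (l div n) (l mod n)) = (\<Sum>i<m. \<Sum>j<n. g i j)"
proof -
  have "(\<Sum>l<m * n. g (l div n) (l mod n)) = (\<Sum>i<m. \<Sum>l = i * n..<i * n + n. g (l div n) (l mod n))"
    by (rule sum.nat_group [symmetric])
  also have "\<dots> = (\<Sum>i<m. \<Sum>j<n. g i j)"
  proof (rule sum.cong [OF refl])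
    fix i
    have "(\<Sum>l = i * n..<i * n + n. g (l div n) (l mod n))
        = (\<Sum>j = 0..<n. g ((j + i * n) div n) ((j + i * n) mod n))"
      using sum.shift_bounds_nat_ivl [of "\<lambda>l. g (l div n) (l mod n)" 0 "i * n" n] by (simp add: add.commute)
    also have "\<dots> = (\<Sum>j<n. g i j)"
      by (rule sum.cong) auto
    finally show "(\<Sum>l = i * n..<i * n + n. g (l div n) (l mod n)) = (\<Sum>j<n. g i j)" .
  qed
  finally show ?thesis .
qed

text \<open>Row-major vectorisation: the left factor (Alice, or the Bank in the cut between
  \<open>K\<close> and the rest) indexes the rows, as the convention of a most significant leftmost
  factor requires.\<close>

definition flat :: "complex mat \<Rightarrow> complex vec" where
  "flat \<Psi> = vec (dim_row \<Psi> * dim_col \<Psi>) (\<lambda>i. \<Psi> $$ (i div dim_col \<Psi>, i mod dim_col \<Psi>))"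

lemma dim_flat [simp]: "dim_vec (flat \<Psi>) = dim_row \<Psi> * dim_col \<Psi>"
  by (simp add: flat_def)

lemma div_mod_less:
  assumes "k < m * (n::nat)"
  shows "k div n < m" "k mod n < n"
proof -
  show "k div n < m" using assms by (simp add: less_mult_imp_div_less)
  have "0 < n" using assms by (cases n) auto
  then show "k mod n < n" by simp
qed

text \<open>The vectorisation identity that moves local operators onto coefficient matrices: Alice
  multiplies from the left, Bob from the right by the transpose, without conjugation.\<close>

lemma kron_mult_flat:
  assumes "A \<in> carrier_mat m a" "B \<in> carrier_mat n b" "\<Psi> \<in> carrier_mat a b"
  shows "kron A B *\<^sub>v flat \<Psi> = flat (A * \<Psi> * B\<^sup>T)"
proof (rule eq_vecI)
  show "dim_vec (kron A B *\<^sub>v flat \<Psi>) = dim_vec (flat (A * \<Psi> * B\<^sup>T))"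
    using assms by (simp add: kron_def)
next
  fix k assume "k < dim_vec (flat (A * \<Psi> * B\<^sup>T))"
  then have k: "k < m * n" using assms by simp
  note km = div_mod_less [OF k]
  have "(kron A B *\<^sub>v flat \<Psi>) $ k
      = (\<Sum>l<a * b. A $$ (k div n, l div b) * B $$ (k mod n, l mod b) * \<Psi> $$ (l div b, l mod b))"
    using assms k by (simp add: kron_def flat_def scalar_prod_def lessThan_atLeast0)
  also have "\<dots> = (\<Sum>i<a. \<Sum>j<b. A $$ (k div n, i) * B $$ (k mod n, j) * \<Psi> $$ (i, j))"
    by (rule sum_div_mod)
  also have "\<dots> = (A * \<Psi> * B\<^sup>T) $$ (k div n, k mod n)"
    using assms km by (simp add: scalar_prod_def lessThan_atLeast0 sum_distrib_right sum_distrib_left mult_ac)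
  also have "\<dots> = flat (A * \<Psi> * B\<^sup>T) $ k"
    using assms k by (simp add: flat_def)
  finally show "(kron A B *\<^sub>v flat \<Psi>) $ k = flat (A * \<Psi> * B\<^sup>T) $ k" .
qed

text \<open>
  Ensembles of pure states; the product of the two dimensions is a separate argument so that an
  empty ensemble has a dimension.
\<close>

definition ens :: "nat \<Rightarrow> complex mat list \<Rightarrow> complex mat" where
  "ens n L = mat n n (\<lambda>ij. \<Sum>\<Psi> \<leftarrow> L. proj (flat \<Psi>) $$ ij)"

lemma ens_carrier [simp]: "ens n L \<in> carrier_mat n n"
  by (simp add: ens_def)

lemma ens_index:
  assumes "set L \<subseteq> carrier_mat a b" "i < a * b" "j < a * b"
  shows "ens (a * b) L $$ (i, j) = (\<Sum>\<Psi> \<leftarrow> L. \<Psi> $$ (i div b, i mod b) * cnj (\<Psi> $$ (j div b, j mod b)))"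
  using assms by (auto simp: ens_def proj_def flat_def intro!: arg_cong [of _ _ sum_list] map_cong)

lemma proj_carrier: "v \<in> carrier_vec n \<Longrightarrow> proj v \<in> carrier_mat n n"
  by (auto simp: proj_def)

lemma flat_carrier: "\<Psi> \<in> carrier_mat a b \<Longrightarrow> flat \<Psi> \<in> carrier_vec (a * b)"
  by (rule carrier_vecI) simp

lemma sandwich_proj:
  assumes "K \<in> carrier_mat m n" "v \<in> carrier_vec n"
  shows "K * proj v * mat_adjoint K = proj (K *\<^sub>v v)"
proof (rule eq_matI)
  fix i j assume "i < dim_row (proj (K *\<^sub>v v))" "j < dim_col (proj (K *\<^sub>v v))"
  then show "(K * proj v * mat_adjoint K) $$ (i, j) = proj (K *\<^sub>v v) $$ (i, j)"
    using assms
    by (simp add: proj_def adjoint_eq scalar_prod_def sum_distrib_left sum_distrib_right mult_ac)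
      (rule sum.swap)
qed (use assms in \<open>simp_all add: proj_def\<close>)

lemma sandwich_ens:
  assumes "A \<in> carrier_mat m a" "B \<in> carrier_mat n b" "set L \<subseteq> carrier_mat a b"
    and "i < m * n" "j < m * n"
  shows "(kron A B * ens (a * b) L * mat_adjoint (kron A B)) $$ (i, j)
       = (\<Sum>\<Psi> \<leftarrow> L. proj (flat (A * \<Psi> * B\<^sup>T)) $$ (i, j))"
proof -
  have K: "kron A B \<in> carrier_mat (m * n) (a * b)" using assms by (simp add: kron_def)
  have K': "mat_adjoint (kron A B) \<in> carrier_mat (a * b) (m * n)"
    using K by (intro carrier_matI) (simp_all only: adjoint_dim carrier_matD)
  show ?thesis
    using assms(3)
  proof (induction L)
    case Nil
    have "ens (a * b) [] = 0\<^sub>m (a * b) (a * b)"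
      by (rule eq_matI) (simp_all add: ens_def)
    then show ?case using K K' assms(4,5)
      by simp
  next
    case (Cons \<Psi> L)
    have v: "flat \<Psi> \<in> carrier_vec (a * b)" using flat_carrier [of \<Psi> a b] Cons.prems by simp
    have P: "proj (flat \<Psi>) \<in> carrier_mat (a * b) (a * b)"
      by (rule proj_carrier [OF v])
    have "ens (a * b) (\<Psi> # L) = proj (flat \<Psi>) + ens (a * b) L"
      using P by (intro eq_matI) (auto simp: ens_def)
    then have "kron A B * ens (a * b) (\<Psi> # L) * mat_adjoint (kron A B)
       = kron A B * proj (flat \<Psi>) * mat_adjoint (kron A B) + kron A B * ens (a * b) L * mat_adjoint (kron A B)"
      using K K' P by (simp add: mult_add_distrib_mat [of _ "m * n" "a * b"] add_mult_distrib_mat [of _ "m * n" "a * b"])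
    moreover have "kron A B * proj (flat \<Psi>) * mat_adjoint (kron A B) = proj (flat (A * \<Psi> * B\<^sup>T))"
      using sandwich_proj [OF K v] kron_mult_flat [OF assms(1,2)] Cons.prems by simp
    moreover have "kron A B * ens (a * b) L * mat_adjoint (kron A B) \<in> carrier_mat (m * n) (m * n)"
      using K K' by (metis ens_carrier mult_carrier_mat)
    ultimately show ?case using Cons assms by auto
  qed
qed

text \<open>Each Kraus operator sends a pure member to a pure member, so ensembles are closed under
  local operations and no mixed state has to be decomposed. Pairs of operators cover Alice's and
  Bob's rounds at once.\<close>

lemma apply_kraus_ens:
  assumes "set As \<subseteq> carrier_mat m a \<times> carrier_mat n b" "set L \<subseteq> carrier_mat a b"
  shows "apply_kraus (m * n) (map (\<lambda>(A, B). kron A B) As) (ens (a * b) L)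
       = ens (m * n) (concat (map (\<lambda>(A, B). map (\<lambda>\<Psi>. A * \<Psi> * B\<^sup>T) L) As))"
proof (rule eq_matI)
  fix i j assume "i < dim_row (ens (m * n) (concat (map (\<lambda>(A, B). map (\<lambda>\<Psi>. A * \<Psi> * B\<^sup>T) L) As)))"
    "j < dim_col (ens (m * n) (concat (map (\<lambda>(A, B). map (\<lambda>\<Psi>. A * \<Psi> * B\<^sup>T) L) As)))"
  then have ij: "i < m * n" "j < m * n" by (simp_all add: ens_def)
  have "(\<Sum>M \<leftarrow> map (\<lambda>(A, B). kron A B) As. (M * ens (a * b) L * mat_adjoint M) $$ (i, j))
     = (\<Sum>\<Phi> \<leftarrow> concat (map (\<lambda>(A, B). map (\<lambda>\<Psi>. A * \<Psi> * B\<^sup>T) L) As). proj (flat \<Phi>) $$ (i, j))"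
    using assms(1)
  proof (induction As)
    case (Cons AB As)
    then show ?case using sandwich_ens [OF _ _ assms(2) ij]
      by (auto simp: comp_def)
  qed simp
  then show "apply_kraus (m * n) (map (\<lambda>(A, B). kron A B) As) (ens (a * b) L) $$ (i, j)
    = ens (m * n) (concat (map (\<lambda>(A, B). map (\<lambda>\<Psi>. A * \<Psi> * B\<^sup>T) L) As)) $$ (i, j)"
    using ij by (simp add: apply_kraus_def ens_def)
qed (simp_all add: apply_kraus_def ens_def)

lemma apply_kraus_Alice:
  assumes "set Ks \<subseteq> carrier_mat m a" "set L \<subseteq> carrier_mat a b"
  shows "apply_kraus (m * b) (map (\<lambda>M. kron M (1\<^sub>m b)) Ks) (ens (a * b) L)
       = ens (m * b) (concat (map (\<lambda>K. map ((*) K) L) Ks))"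
proof -
  have "set (map (\<lambda>K. (K, 1\<^sub>m b)) Ks) \<subseteq> carrier_mat m a \<times> carrier_mat b b"
    using assms(1) by auto
  from apply_kraus_ens [OF this assms(2)]
  have "apply_kraus (m * b) (map (\<lambda>M. kron M (1\<^sub>m b)) Ks) (ens (a * b) L)
      = ens (m * b) (concat (map (\<lambda>K. map (\<lambda>\<Psi>. K * \<Psi> * (1\<^sub>m b)\<^sup>T) L) Ks))"
    by (simp add: comp_def)
  also have "concat (map (\<lambda>K. map (\<lambda>\<Psi>. K * \<Psi> * (1\<^sub>m b)\<^sup>T) L) Ks) = concat (map (\<lambda>K. map ((*) K) L) Ks)"
    using assms by (intro arg_cong [of _ _ concat] map_cong refl) (auto simp: right_mult_one_mat')
  finally show ?thesis .
qed

lemma apply_kraus_Bob: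
  assumes "set Ks \<subseteq> carrier_mat n b" "set L \<subseteq> carrier_mat a b"
  shows "apply_kraus (a * n) (map (\<lambda>M. kron (1\<^sub>m a) M) Ks) (ens (a * b) L)
       = ens (a * n) (concat (map (\<lambda>K. map (\<lambda>\<Psi>. \<Psi> * K\<^sup>T) L) Ks))"
proof -
  have "set (map (\<lambda>K. (1\<^sub>m a, K)) Ks) \<subseteq> carrier_mat a a \<times> carrier_mat n b"
    using assms(1) by auto
  from apply_kraus_ens [OF this assms(2)]
  have "apply_kraus (a * n) (map (\<lambda>M. kron (1\<^sub>m a) M) Ks) (ens (a * b) L)
      = ens (a * n) (concat (map (\<lambda>K. map (\<lambda>\<Psi>. 1\<^sub>m a * \<Psi> * K\<^sup>T) L) Ks))"
    by (simp add: comp_def)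
  also have "concat (map (\<lambda>K. map (\<lambda>\<Psi>. 1\<^sub>m a * \<Psi> * K\<^sup>T) L) Ks) = concat (map (\<lambda>K. map (\<lambda>\<Psi>. \<Psi> * K\<^sup>T) L) Ks)"
    using assms by (intro arg_cong [of _ _ concat] map_cong refl) (auto simp: left_mult_one_mat')
  finally show ?thesis .
qed

subsection \<open>The bound on the largest Schmidt coefficient\<close>

definition nrm :: "complex mat \<Rightarrow> real" where
  "nrm \<Psi> = (\<Sum>i<dim_row \<Psi>. \<Sum>j<dim_col \<Psi>. (cmod (\<Psi> $$ (i, j)))\<^sup>2)"

text \<open>Over unit vectors the left side has the squared operator norm of \<open>\<Psi>\<close>
  as its supremum, while \<open>nrm\<close> is the squared Frobenius norm. The homogeneous form
  suits unnormalised and zero branches; since \<open>u\<close> and \<open>v\<close> are arbitrary,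
  conjugating them would change nothing.\<close>

definition half_bounded :: "complex mat \<Rightarrow> bool" where
  "half_bounded \<Psi> \<longleftrightarrow> (\<forall>u v.
     (cmod (\<Sum>i<dim_row \<Psi>. \<Sum>j<dim_col \<Psi>. u i * \<Psi> $$ (i, j) * v j))\<^sup>2
     \<le> 1 / 2 * (\<Sum>i<dim_row \<Psi>. (cmod (u i))\<^sup>2) * (\<Sum>j<dim_col \<Psi>. (cmod (v j))\<^sup>2) * nrm \<Psi>)"

lemma nrm_transpose [simp]: "nrm \<Psi>\<^sup>T = nrm \<Psi>"
  by (simp add: nrm_def sum.swap [of _ "{..<dim_row \<Psi>}"])

lemma half_bounded_transpose [simp]: "half_bounded \<Psi>\<^sup>T \<longleftrightarrow> half_bounded \<Psi>"
proof -
  have "half_bounded \<Psi>\<^sup>T" if "half_bounded \<Psi>" for \<Psi>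
    unfolding half_bounded_def
  proof (intro allI)
    fix u v :: "nat \<Rightarrow> complex"
    have "(\<Sum>i<dim_row \<Psi>\<^sup>T. \<Sum>j<dim_col \<Psi>\<^sup>T. u i * \<Psi>\<^sup>T $$ (i, j) * v j)
        = (\<Sum>i<dim_row \<Psi>. \<Sum>j<dim_col \<Psi>. v i * \<Psi> $$ (i, j) * u j)"
      by (subst sum.swap) (simp add: mult_ac)
    from this [symmetric] show "(cmod (\<Sum>i<dim_row \<Psi>\<^sup>T. \<Sum>j<dim_col \<Psi>\<^sup>T. u i * \<Psi>\<^sup>T $$ (i, j) * v j))\<^sup>2
     \<le> 1 / 2 * (\<Sum>i<dim_row \<Psi>\<^sup>T. (cmod (u i))\<^sup>2) * (\<Sum>j<dim_col \<Psi>\<^sup>T. (cmod (v j))\<^sup>2) * nrm \<Psi>\<^sup>T"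
      using that [unfolded half_bounded_def, rule_format, of v u] by (simp add: mult_ac)
  qed
  from this [of \<Psi>] this [of "\<Psi>\<^sup>T"] show ?thesis by auto
qed

lemma Cauchy_Schwarz_cmod:
  "(cmod (\<Sum>i\<in>A. u i * w i))\<^sup>2 \<le> (\<Sum>i\<in>A. (cmod (u i))\<^sup>2) * (\<Sum>i\<in>A. (cmod (w i))\<^sup>2)"
proof -
  have "cmod (\<Sum>i\<in>A. u i * w i) \<le> (\<Sum>i\<in>A. cmod (u i) * cmod (w i))"
    by (rule order.trans [OF norm_sum]) (simp add: norm_mult)
  also have "\<dots> \<le> L2_set (\<lambda>i. cmod (u i)) A * L2_set (\<lambda>i. cmod (w i)) A"
    using L2_set_mult_ineq [of "\<lambda>i. cmod (u i)" "\<lambda>i. cmod (w i)" A] by simp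
  finally have "(cmod (\<Sum>i\<in>A. u i * w i))\<^sup>2 \<le> (L2_set (\<lambda>i. cmod (u i)) A * L2_set (\<lambda>i. cmod (w i)) A)\<^sup>2"
    by (simp add: power_mono)
  then show ?thesis by (simp add: power_mult_distrib L2_set_def sum_nonneg)
qed

section \<open>Complete families of Kraus operators\<close>

text \<open>The outcomes are pooled, since pulling the bound back needs only completeness; the
  output dimension may vary from one operator to the next.\<close>

definition kraus_complete :: "nat \<Rightarrow> complex mat list \<Rightarrow> bool" where
  "kraus_complete m Ks \<longleftrightarrow> (\<forall>K \<in> set Ks. dim_col K = m) \<and>
     (\<forall>i<m. \<forall>j<m. (\<Sum>K \<leftarrow> Ks. (mat_adjoint K * K) $$ (i, j)) = (if i = j then 1 else 0))"

lemma sum_list_sum_swap: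
  "(\<Sum>K \<leftarrow> Ks. \<Sum>i\<in>A. f K i) = (\<Sum>i\<in>A. \<Sum>K \<leftarrow> Ks. (f K i :: 'a::comm_monoid_add))"
  by (induction Ks) (simp_all add: sum.distrib)

lemma of_real_sum_list: "of_real (\<Sum>x \<leftarrow> xs. f x) = (\<Sum>x \<leftarrow> xs. complex_of_real (f x))"
  by (induction xs) simp_all

lemma instr_complete:
  assumes "is_instr d I"
  shows "kraus_complete d (concat (map snd I))"
proof -
  have carr: "set Ks \<subseteq> carrier_mat e d" if "(e, Ks) \<in> set I" for e Ks
    using assms that by (auto simp: is_instr_def)
  have "(\<Sum>K \<leftarrow> concat (map snd I). (mat_adjoint K * K) $$ (i, j)) = (if i = j then 1 else 0)"
    if "i < d" "j < d" for i j
  proof -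
    have "(\<Sum>K \<leftarrow> concat (map snd J). (mat_adjoint K * K) $$ (i, j))
      = (\<Sum>(e, Ks) \<leftarrow> J. \<Sum>M \<leftarrow> Ks. (mat_adjoint M * M) $$ (i, j))" for J :: instr
      by (induction J) auto
    moreover have "mat d d (\<lambda>ij. \<Sum>(e, Ks) \<leftarrow> I. \<Sum>M \<leftarrow> Ks. (mat_adjoint M * M) $$ ij) $$ (i, j)
        = 1\<^sub>m d $$ (i, j)"
      using assms by (simp add: is_instr_def)
    ultimately show ?thesis using that by simp
  qed
  then show ?thesis
    unfolding kraus_complete_def using carr by fastforce
qed

text \<open>Stacked on top of each other the operators form an isometry: expanding the squares
  yields the quadratic form of the sum of all \<open>mat_adjoint K * K\<close>, which is the
  identity.\<close>

lemma kraus_isometry: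
  assumes "kraus_complete m Ks"
  shows "(\<Sum>K \<leftarrow> Ks. \<Sum>r<dim_row K. (cmod (\<Sum>i<m. K $$ (r, i) * w i))\<^sup>2) = (\<Sum>i<m. (cmod (w i))\<^sup>2)"
proof -
  \<comment> \<open>The computation is done in the complex numbers, where |z|^2 = z
    \<open>cnj\<close> z can be expanded.\<close>
  have "(\<Sum>r<dim_row K. complex_of_real ((cmod (\<Sum>i<m. K $$ (r, i) * w i))\<^sup>2))
      = (\<Sum>i<m. \<Sum>j<m. w i * cnj (w j) * (mat_adjoint K * K) $$ (j, i))" if "K \<in> set Ks" for K
  proof -
    have [simp]: "dim_col K = m" using assms that by (simp add: kraus_complete_def)
    have "(\<Sum>r<dim_row K. complex_of_real ((cmod (\<Sum>i<m. K $$ (r, i) * w i))\<^sup>2))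
        = (\<Sum>r<dim_row K. \<Sum>i<m. \<Sum>j<m. K $$ (r, i) * w i * (cnj (K $$ (r, j)) * cnj (w j)))"
      by (simp add: complex_norm_square [unfolded of_real_power] sum_product)
    also have "\<dots> = (\<Sum>i<m. \<Sum>j<m. \<Sum>r<dim_row K. K $$ (r, i) * w i * (cnj (K $$ (r, j)) * cnj (w j)))"
      by (subst sum.swap) (simp add: sum.swap [of _ "{..<dim_row K}"])
    also have "\<dots> = (\<Sum>i<m. \<Sum>j<m. w i * cnj (w j) * (mat_adjoint K * K) $$ (j, i))"
      by (simp add: adjoint_eq scalar_prod_def sum_distrib_left lessThan_atLeast0 mult_ac)
    finally show ?thesis .
  qed
  then have "complex_of_real (\<Sum>K \<leftarrow> Ks. \<Sum>r<dim_row K. (cmod (\<Sum>i<m. K $$ (r, i) * w i))\<^sup>2)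
      = (\<Sum>K \<leftarrow> Ks. \<Sum>i<m. \<Sum>j<m. w i * cnj (w j) * (mat_adjoint K * K) $$ (j, i))"
    unfolding of_real_sum_list of_real_sum by (intro arg_cong [of _ _ sum_list] map_cong refl)
  also have "\<dots> = (\<Sum>i<m. \<Sum>j<m. w i * cnj (w j) * (\<Sum>K \<leftarrow> Ks. (mat_adjoint K * K) $$ (j, i)))"
    by (simp add: sum_list_sum_swap sum_list_const_mult)
  also have "\<dots> = (\<Sum>i<m. \<Sum>j<m. if j = i then w i * cnj (w j) else 0)"
    using assms by (intro sum.cong refl) (simp add: kraus_complete_def)
  also have "\<dots> = complex_of_real (\<Sum>i<m. (cmod (w i))\<^sup>2)"
    by (simp add: complex_norm_square [unfolded of_real_power])
  finally show ?thesis by (simp only: of_real_eq_iff)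
qed

lemma nrm_swap: "nrm \<Psi> = (\<Sum>j<dim_col \<Psi>. \<Sum>i<dim_row \<Psi>. (cmod (\<Psi> $$ (i, j)))\<^sup>2)"
  unfolding nrm_def by (rule sum.swap)

text \<open>This is \<open>kraus_isometry\<close> column by column; the branch probabilities add up
  to that of the parent.\<close>

lemma sum_list_nrm_kraus:
  assumes "kraus_complete (dim_row \<Psi>) Ks"
  shows "(\<Sum>K \<leftarrow> Ks. nrm (K * \<Psi>)) = nrm \<Psi>"
proof -
  have "nrm (K * \<Psi>) = (\<Sum>j<dim_col \<Psi>. \<Sum>r<dim_row K.
      (cmod (\<Sum>i<dim_row \<Psi>. K $$ (r, i) * \<Psi> $$ (i, j)))\<^sup>2)" if "K \<in> set Ks" for K
    using assms that by (simp add: nrm_swap kraus_complete_def scalar_prod_def lessThan_atLeast0)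
  then have "(\<Sum>K \<leftarrow> Ks. nrm (K * \<Psi>)) = (\<Sum>K \<leftarrow> Ks. \<Sum>j<dim_col \<Psi>. \<Sum>r<dim_row K.
      (cmod (\<Sum>i<dim_row \<Psi>. K $$ (r, i) * \<Psi> $$ (i, j)))\<^sup>2)"
    by (intro arg_cong [of _ _ sum_list] map_cong refl)
  also have "\<dots> = nrm \<Psi>"
    by (simp add: sum_list_sum_swap kraus_isometry [OF assms] nrm_swap)
  finally show ?thesis .
qed

text \<open>
  With \<open>w = \<Psi> v\<close> and \<open>z = K w\<close>, the bound for \<open>K \<Psi>\<close> at the product vector given by \<open>cnj z\<close> and \<open>v\<close>
  bounds \<open>|K w|\<^sup>2\<close>, and the sum of these squares over \<open>K\<close> is \<open>|w|\<^sup>2\<close>.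
\<close>

lemma half_bounded_pullback:
  assumes Ks: "kraus_complete (dim_row \<Psi>) Ks" and half: "\<And>K. K \<in> set Ks \<Longrightarrow> half_bounded (K * \<Psi>)"
  shows "half_bounded \<Psi>"
  unfolding half_bounded_def
proof (intro allI)
  fix u v :: "nat \<Rightarrow> complex"
  define w where "w i = (\<Sum>j<dim_col \<Psi>. \<Psi> $$ (i, j) * v j)" for i
  define V where "V = (\<Sum>j<dim_col \<Psi>. (cmod (v j))\<^sup>2)"
  have step: "(\<Sum>r<dim_row K. (cmod (\<Sum>i<dim_row \<Psi>. K $$ (r, i) * w i))\<^sup>2) \<le> 1 / 2 * V * nrm (K * \<Psi>)"
    if "K \<in> set Ks" for K
  proof -
    define z where "z r = (\<Sum>i<dim_row \<Psi>. K $$ (r, i) * w i)" for r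
    define Z where "Z = (\<Sum>r<dim_row K. (cmod (z r))\<^sup>2)"
    have [simp]: "dim_col K = dim_row \<Psi>" using Ks that by (simp add: kraus_complete_def)
    have z: "z r = (\<Sum>j<dim_col \<Psi>. (K * \<Psi>) $$ (r, j) * v j)" if "r < dim_row K" for r
    proof -
      have "z r = (\<Sum>i<dim_row \<Psi>. \<Sum>j<dim_col \<Psi>. K $$ (r, i) * \<Psi> $$ (i, j) * v j)"
        by (simp add: z_def w_def sum_distrib_left mult_ac)
      also have "\<dots> = (\<Sum>j<dim_col \<Psi>. \<Sum>i<dim_row \<Psi>. K $$ (r, i) * \<Psi> $$ (i, j) * v j)"
        by (rule sum.swap)
      also have "\<dots> = (\<Sum>j<dim_col \<Psi>. (K * \<Psi>) $$ (r, j) * v j)"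
        using that by (simp add: scalar_prod_def lessThan_atLeast0 sum_distrib_right)
      finally show ?thesis .
    qed
    have "(\<Sum>i<dim_row K. \<Sum>j<dim_col \<Psi>. cnj (z i) * (K * \<Psi>) $$ (i, j) * v j) = (\<Sum>i<dim_row K. cnj (z i) * z i)"
      by (rule sum.cong) (simp_all add: z sum_distrib_left mult.assoc)
    also have "\<dots> = complex_of_real Z"
      unfolding Z_def of_real_sum
      by (rule sum.cong) (simp_all add: complex_norm_square [unfolded of_real_power] mult.commute)
    finally have "(\<Sum>i<dim_row K. \<Sum>j<dim_col \<Psi>. cnj (z i) * (K * \<Psi>) $$ (i, j) * v j) = complex_of_real Z" .
    then have "Z\<^sup>2 \<le> 1 / 2 * Z * V * nrm (K * \<Psi>)"
      using half [OF that, unfolded half_bounded_def, rule_format, of "\<lambda>i. cnj (z i)" v]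
      by (simp only: index_mult_mat(2,3) norm_of_real power2_abs complex_mod_cnj Z_def [symmetric] V_def [symmetric])
    moreover have "0 \<le> Z" by (simp add: Z_def sum_nonneg)
    moreover have "0 \<le> V * nrm (K * \<Psi>)" by (simp add: V_def nrm_def sum_nonneg)
    \<comment> \<open>One factor \<open>Z\<close> cancels; for \<open>Z = 0\<close> the right side
      is nonnegative anyway.\<close>
    ultimately have "Z \<le> 1 / 2 * V * nrm (K * \<Psi>)"
      by (cases "Z = 0") (simp_all add: power2_eq_square field_simps)
    then show ?thesis by (simp add: Z_def z_def)
  qed
  have "(\<Sum>i<dim_row \<Psi>. (cmod (w i))\<^sup>2)
      = (\<Sum>K \<leftarrow> Ks. \<Sum>r<dim_row K. (cmod (\<Sum>i<dim_row \<Psi>. K $$ (r, i) * w i))\<^sup>2)"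
    using kraus_isometry [OF Ks] by simp
  also have "\<dots> \<le> (\<Sum>K \<leftarrow> Ks. 1 / 2 * V * nrm (K * \<Psi>))"
    using step by (rule sum_list_mono)
  also have "\<dots> = 1 / 2 * V * nrm \<Psi>"
    by (simp only: sum_list_const_mult sum_list_nrm_kraus [OF Ks])
  finally have w: "(\<Sum>i<dim_row \<Psi>. (cmod (w i))\<^sup>2) \<le> 1 / 2 * V * nrm \<Psi>" .
  \<comment> \<open>Cauchy-Schwarz in \<open>u\<close> leaves only |\<Psi> v|^2, which has just been
    bounded.\<close>
  have "(cmod (\<Sum>i<dim_row \<Psi>. \<Sum>j<dim_col \<Psi>. u i * \<Psi> $$ (i, j) * v j))\<^sup>2
      = (cmod (\<Sum>i<dim_row \<Psi>. u i * w i))\<^sup>2"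
    by (simp add: w_def sum_distrib_left mult.assoc)
  also have "\<dots> \<le> (\<Sum>i<dim_row \<Psi>. (cmod (u i))\<^sup>2) * (\<Sum>i<dim_row \<Psi>. (cmod (w i))\<^sup>2)"
    by (rule Cauchy_Schwarz_cmod)
  also have "\<dots> \<le> (\<Sum>i<dim_row \<Psi>. (cmod (u i))\<^sup>2) * (1 / 2 * V * nrm \<Psi>)"
    using w by (intro mult_left_mono sum_nonneg) simp_all
  finally show "(cmod (\<Sum>i<dim_row \<Psi>. \<Sum>j<dim_col \<Psi>. u i * \<Psi> $$ (i, j) * v j))\<^sup>2
     \<le> 1 / 2 * (\<Sum>i<dim_row \<Psi>. (cmod (u i))\<^sup>2) * (\<Sum>j<dim_col \<Psi>. (cmod (v j))\<^sup>2) * nrm \<Psi>"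
    by (simp add: V_def mult_ac)
qed

section \<open>Final states that contain a Bell pair\<close>

lemma mtrace_ens:
  assumes "set L \<subseteq> carrier_mat a b"
  shows "mtrace (ens (a * b) L) = complex_of_real (\<Sum>\<Psi> \<leftarrow> L. nrm \<Psi>)"
proof -
  have "mtrace (ens (a * b) L) = (\<Sum>i<a * b. ens (a * b) L $$ (i, i))"
    by (simp add: mtrace_def ens_def)
  also have "\<dots> = (\<Sum>i<a * b. \<Sum>\<Psi> \<leftarrow> L. \<Psi> $$ (i div b, i mod b) * cnj (\<Psi> $$ (i div b, i mod b)))"
    by (rule sum.cong) (simp_all add: ens_index [OF assms])
  also have "\<dots> = (\<Sum>\<Psi> \<leftarrow> L. \<Sum>i<a * b. \<Psi> $$ (i div b, i mod b) * cnj (\<Psi> $$ (i div b, i mod b)))"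
    by (rule sum_list_sum_swap [symmetric])
  also have "\<dots> = (\<Sum>\<Psi> \<leftarrow> L. complex_of_real (nrm \<Psi>))"
  proof (intro arg_cong [of _ _ sum_list] map_cong refl)
    fix \<Psi> assume "\<Psi> \<in> set L"
    then have "dim_row \<Psi> = a" "dim_col \<Psi> = b" using assms by auto
    then show "(\<Sum>i<a * b. \<Psi> $$ (i div b, i mod b) * cnj (\<Psi> $$ (i div b, i mod b))) = complex_of_real (nrm \<Psi>)"
      by (simp add: sum_div_mod [of "\<lambda>i j. \<Psi> $$ (i, j) * cnj (\<Psi> $$ (i, j))"] nrm_def
          complex_norm_square [unfolded of_real_power])
  qed
  finally show ?thesis by (simp add: of_real_sum_list)
qed

text \<open>Branches of probability zero are left unconstrained by \<open>restores_bell\<close>, but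
  the backward induction needs the bound for them too.\<close>

lemma half_bounded_zero:
  assumes "nrm \<Psi> = 0"
  shows "half_bounded \<Psi>"
proof -
  have "\<Psi> $$ (i, j) = 0" if "i < dim_row \<Psi>" "j < dim_col \<Psi>" for i j
    using assms that by (simp add: nrm_def sum_nonneg_eq_0_iff sum_nonneg)
  then show ?thesis by (simp add: half_bounded_def assms)
qed

lemma sum_double:
  fixes f :: "nat \<Rightarrow> 'a::comm_monoid_add"
  shows "(\<Sum>i<2 * r. f i) = (\<Sum>x<r. f x + f (r + x))"
proof -
  have "(\<Sum>i<2 * r. f i) = (\<Sum>i<r. f i) + (\<Sum>i = r..<r + r. f i)"
    using sum.atLeastLessThan_concat [of 0 r "r + r" f] by (simp add: lessThan_atLeast0 mult_2)
  also have "(\<Sum>i = r..<r + r. f i) = (\<Sum>x<r. f (r + x))"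
    using sum.shift_bounds_nat_ivl [of f 0 r r] by (simp add: lessThan_atLeast0 add.commute)
  finally show ?thesis by (simp add: sum.distrib)
qed

text \<open>The matrix is block diagonal with two equal blocks X, i.e. an unnormalised Bell pair
  times a state with coefficients X. The bilinear form is the sum of \<open>g x y\<close> X(x, y).
  Cauchy-Schwarz over the pairs (x, y) and again for the two terms of \<open>g\<close> bounds it by
  the norm of X, and \<open>nrm\<close> counts X twice: hence the 1/2.\<close>

lemma half_bounded_bell_block:
  assumes carr: "\<Psi> \<in> carrier_mat (2 * r) (2 * s)"
    and off1: "\<And>x y. x < r \<Longrightarrow> y < s \<Longrightarrow> \<Psi> $$ (x, s + y) = 0"
    and off2: "\<And>x y. x < r \<Longrightarrow> y < s \<Longrightarrow> \<Psi> $$ (r + x, y) = 0"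
    and diag: "\<And>x y. x < r \<Longrightarrow> y < s \<Longrightarrow> \<Psi> $$ (r + x, s + y) = \<Psi> $$ (x, y)"
  shows "half_bounded \<Psi>"
  unfolding half_bounded_def
proof (intro allI)
  fix u v :: "nat \<Rightarrow> complex"
  define g where "g x y = u x * v y + u (r + x) * v (s + y)" for x y
  define J where "J = (\<Sum>(x, y) \<in> {..<r} \<times> {..<s}. (cmod (\<Psi> $$ (x, y)))\<^sup>2)"
  have "J = (\<Sum>x<r. \<Sum>y<s. (cmod (\<Psi> $$ (x, y)))\<^sup>2)"
    by (simp add: J_def sum.cartesian_product)
  then have nrm: "nrm \<Psi> = 2 * J"
    using carr by (simp add: nrm_def sum_double off1 off2 diag sum.distrib)
  \<comment> \<open>Two-term Cauchy-Schwarz, with \<open>bool\<close> as the index set.\<close>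
  have g: "(cmod (g x y))\<^sup>2 \<le> ((cmod (u x))\<^sup>2 + (cmod (u (r + x)))\<^sup>2) * ((cmod (v y))\<^sup>2 + (cmod (v (s + y)))\<^sup>2)"
    for x y
    using Cauchy_Schwarz_cmod [of "\<lambda>c. if c then u x else u (r + x)" "\<lambda>c. if c then v y else v (s + y)" UNIV]
    by (simp add: UNIV_bool g_def add_ac)
  have "(\<Sum>i<dim_row \<Psi>. \<Sum>j<dim_col \<Psi>. u i * \<Psi> $$ (i, j) * v j)
      = (\<Sum>(x, y) \<in> {..<r} \<times> {..<s}. g x y * \<Psi> $$ (x, y))"
    using carr by (simp add: sum_double off1 off2 diag sum.cartesian_product [symmetric])
      (simp add: g_def algebra_simps sum.distrib)
  then have "(cmod (\<Sum>i<dim_row \<Psi>. \<Sum>j<dim_col \<Psi>. u i * \<Psi> $$ (i, j) * v j))\<^sup>2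
      \<le> (\<Sum>(x, y) \<in> {..<r} \<times> {..<s}. (cmod (g x y))\<^sup>2) * J"
    using Cauchy_Schwarz_cmod [of "\<lambda>(x, y). g x y" "\<lambda>(x, y). \<Psi> $$ (x, y)" "{..<r} \<times> {..<s}"]
    by (simp add: J_def case_prod_unfold)
  also have "\<dots> \<le> (\<Sum>(x, y) \<in> {..<r} \<times> {..<s}.
      ((cmod (u x))\<^sup>2 + (cmod (u (r + x)))\<^sup>2) * ((cmod (v y))\<^sup>2 + (cmod (v (s + y)))\<^sup>2)) * J"
    using g by (intro mult_right_mono sum_mono) (auto simp: J_def intro!: sum_nonneg)
  also have "\<dots> = (\<Sum>i<2 * r. (cmod (u i))\<^sup>2) * (\<Sum>j<2 * s. (cmod (v j))\<^sup>2) * J"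
    by (simp only: sum_double sum_product sum.cartesian_product)
  finally show "(cmod (\<Sum>i<dim_row \<Psi>. \<Sum>j<dim_col \<Psi>. u i * \<Psi> $$ (i, j) * v j))\<^sup>2
     \<le> 1 / 2 * (\<Sum>i<dim_row \<Psi>. (cmod (u i))\<^sup>2) * (\<Sum>j<dim_col \<Psi>. (cmod (v j))\<^sup>2) * nrm \<Psi>"
    using carr nrm by simp
qed

lemma reduce_AB_ens:
  assumes L: "set L \<subseteq> carrier_mat (2 * r) (2 * s)" and "i < 4" "j < 4"
  shows "reduce_AB r s (ens (2 * r * (2 * s)) L) $$ (i, j)
    = (\<Sum>x<r. \<Sum>y<s. \<Sum>\<Psi> \<leftarrow> L. \<Psi> $$ (i div 2 * r + x, i mod 2 * s + y) * cnj (\<Psi> $$ (j div 2 * r + x, j mod 2 * s + y)))"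
proof -
  have idx: "(i div 2 * r + x) * (2 * s) + (i mod 2 * s + y) < 2 * r * (2 * s)"
    "((i div 2 * r + x) * (2 * s) + (i mod 2 * s + y)) div (2 * s) = i div 2 * r + x"
    "((i div 2 * r + x) * (2 * s) + (i mod 2 * s + y)) mod (2 * s) = i mod 2 * s + y"
    if "i < 4" "x < r" "y < s" for i x y :: nat
  proof -
    have "i div 2 = 0 \<or> i div 2 = 1" using that by auto
    then have 1: "i div 2 * r + x < 2 * r" using that by auto
    have "i mod 2 = 0 \<or> i mod 2 = 1" by auto
    then have 2: "i mod 2 * s + y < 2 * s" using that by auto
    have "(i div 2 * r + x) * (2 * s) + (i mod 2 * s + y) < Suc (i div 2 * r + x) * (2 * s)"
      using 2 by simp
    also have "\<dots> \<le> 2 * r * (2 * s)" using 1 by (intro mult_right_mono) simp_all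
    finally show "(i div 2 * r + x) * (2 * s) + (i mod 2 * s + y) < 2 * r * (2 * s)" .
    show "((i div 2 * r + x) * (2 * s) + (i mod 2 * s + y)) div (2 * s) = i div 2 * r + x"
      "((i div 2 * r + x) * (2 * s) + (i mod 2 * s + y)) mod (2 * s) = i mod 2 * s + y"
      using 2 by (simp_all only: div_mult_self3 mod_mult_self3 div_less mod_less)
  qed
  show ?thesis
    using assms(2,3)
    by (simp only: reduce_AB_def index_mat(1) split_conv)
      (intro sum.cong refl, subst ens_index [OF L], simp_all only: idx lessThan_iff)
qed

text \<open>Matrix entries are complex, so the sum is first moved to the reals, where nonnegative
  terms with sum 0 all vanish.\<close>

lemma nested_sum_zeroD:
  fixes r s :: nat
  assumes "(\<Sum>x<r. \<Sum>y<s. \<Sum>\<Psi> \<leftarrow> L. complex_of_real (f x y \<Psi>)) = 0"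
    and nonneg: "\<And>x y \<Psi>. 0 \<le> f x y \<Psi>"
    and "x < r" "y < s" "\<Psi> \<in> set L"
  shows "f x y \<Psi> = 0"
proof -
  have nn: "0 \<le> (\<Sum>\<Psi> \<leftarrow> L. f x y \<Psi>)" for x y
    by (rule sum_list_nonneg) (auto simp: nonneg)
  have "complex_of_real (\<Sum>x<r. \<Sum>y<s. \<Sum>\<Psi> \<leftarrow> L. f x y \<Psi>) = 0"
    using assms(1) by (simp add: of_real_sum_list)
  then have "(\<Sum>x<r. \<Sum>y<s. \<Sum>\<Psi> \<leftarrow> L. f x y \<Psi>) = 0"
    by (simp only: of_real_eq_0_iff)
  then have "(\<Sum>y<s. \<Sum>\<Psi> \<leftarrow> L. f x y \<Psi>) = 0"
    by (rule sum_nonneg_0 [rotated 2]) (use assms(3) in \<open>simp_all add: sum_nonneg nn\<close>)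
  then have "(\<Sum>\<Psi> \<leftarrow> L. f x y \<Psi>) = 0"
    by (rule sum_nonneg_0 [rotated 2]) (use assms(4) in \<open>simp_all add: nn\<close>)
  then show ?thesis
    using assms(5) nonneg by (subst (asm) sum_list_nonneg_eq_0_iff) auto
qed

lemma proj_bell_index:
  assumes "i < 4" "j < 4"
  shows "proj bell $$ (i, j) = (if i \<in> {0, 3} \<and> j \<in> {0, 3} then 1 / 2 else 0)"
proof -
  have "i = 0 \<or> i = 1 \<or> i = 2 \<or> i = 3" "j = 0 \<or> j = 1 \<or> j = 2 \<or> j = 3" using assms by auto
  moreover have "complex_of_real (sqrt 2) * complex_of_real (sqrt 2) = 2"
    by (metis of_real_mult of_real_numeral real_sqrt_mult_self abs_numeral)
  ultimately show ?thesis
    by (elim disjE) (simp_all add: proj_def bell_def vec_of_list_index numeral_eq_Suc)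
qed

text \<open>If a mixture has a pure reduced state, then so does each nonzero member, and it is the
  same one. Concretely, the weights of the reduced state on |01>, |10> and |00> - |11> are sums of
  squares over all members; they vanish for the Bell state, which forces the block form on each
  member.\<close>

lemma half_bounded_if_bell:
  assumes L: "set L \<subseteq> carrier_mat a b" and ev: "even a" "even b"
    and bell: "mtrace (ens (a * b) L) \<noteq> 0 \<longrightarrow>
      (1 / mtrace (ens (a * b) L)) \<cdot>\<^sub>m reduce_AB (a div 2) (b div 2) (ens (a * b) L) = proj bell"
    and \<Psi>: "\<Psi> \<in> set L"
  shows "half_bounded \<Psi>"
proof (cases "mtrace (ens (a * b) L) = 0")
  \<comment> \<open>Probability zero: the norms add up to 0, so every member is the zero
    matrix.\<close>
  case True
  then have "(\<Sum>\<Psi> \<leftarrow> L. nrm \<Psi>) = 0" by (simp add: mtrace_ens [OF L])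
  moreover have "0 \<le> nrm \<Psi>" for \<Psi> by (simp add: nrm_def sum_nonneg)
  ultimately have "nrm \<Psi> = 0"
    using \<Psi> by (subst (asm) sum_list_nonneg_eq_0_iff) auto
  then show ?thesis by (rule half_bounded_zero)
next
  case False
  define t where "t = mtrace (ens (a * b) L)"
  obtain r s where rs: "a = 2 * r" "b = 2 * s" using ev by (auto elim!: evenE)
  have half: "a div 2 = r" "b div 2 = s" by (simp_all add: rs)
  define R where "R = reduce_AB r s (ens (a * b) L)"
  have "R $$ (i, j) = (if i \<in> {0, 3} \<and> j \<in> {0, 3} then t / 2 else 0)" if "i < 4" "j < 4" for i j
  proof -
    have "((1 / t) \<cdot>\<^sub>m R) $$ (i, j) = proj bell $$ (i, j)"
      using bell False by (simp only: R_def t_def half simp_thms)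
    moreover have "R \<in> carrier_mat 4 4" by (simp add: R_def reduce_AB_def)
    ultimately show ?thesis
      using that False by (simp add: proj_bell_index t_def field_simps split: if_splits)
  qed
  note R = this
  have Rsum: "R $$ (i, j) = (\<Sum>x<r. \<Sum>y<s. \<Sum>\<Psi> \<leftarrow> L.
      \<Psi> $$ (i div 2 * r + x, i mod 2 * s + y) * cnj (\<Psi> $$ (j div 2 * r + x, j mod 2 * s + y)))"
    if "i < 4" "j < 4" for i j
    unfolding R_def rs using L that by (intro reduce_AB_ens) (simp_all only: rs)
  have "(\<Sum>x<r. \<Sum>y<s. \<Sum>\<Psi> \<leftarrow> L. complex_of_real ((cmod (\<Psi> $$ (x, s + y)))\<^sup>2)) = R $$ (1, 1)"
    by (simp add: Rsum complex_norm_square [unfolded of_real_power])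
  also have "\<dots> = 0" by (simp add: R)
  finally have "(cmod (\<Psi> $$ (x, s + y)))\<^sup>2 = 0" if "x < r" "y < s" for x y
    by (rule nested_sum_zeroD) (simp_all add: that \<Psi>)
  then have 1: "\<Psi> $$ (x, s + y) = 0" if "x < r" "y < s" for x y
    using that by simp
  have "(\<Sum>x<r. \<Sum>y<s. \<Sum>\<Psi> \<leftarrow> L. complex_of_real ((cmod (\<Psi> $$ (r + x, y)))\<^sup>2)) = R $$ (2, 2)"
    by (simp add: Rsum complex_norm_square [unfolded of_real_power])
  also have "\<dots> = 0" by (simp add: R)
  finally have "(cmod (\<Psi> $$ (r + x, y)))\<^sup>2 = 0" if "x < r" "y < s" for x y
    by (rule nested_sum_zeroD) (simp_all add: that \<Psi>)
  then have 2: "\<Psi> $$ (r + x, y) = 0" if "x < r" "y < s" for x y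
    using that by simp
  \<comment> \<open>The right side is the expectation of the reduced state in the unnormalised
    vector |00> - |11>; all four entries equal \<open>t / 2\<close>.\<close>
  have "(\<Sum>x<r. \<Sum>y<s. \<Sum>\<Psi> \<leftarrow> L. complex_of_real ((cmod (\<Psi> $$ (r + x, s + y) - \<Psi> $$ (x, y)))\<^sup>2))
      = R $$ (0, 0) + R $$ (3, 3) - R $$ (0, 3) - R $$ (3, 0)"
    by (simp add: Rsum complex_norm_square [unfolded of_real_power] algebra_simps
        sum_list_addf sum_list_subtractf sum.distrib sum_subtractf)
  also have "\<dots> = 0" by (simp add: R)
  finally have "(cmod (\<Psi> $$ (r + x, s + y) - \<Psi> $$ (x, y)))\<^sup>2 = 0" if "x < r" "y < s" for x y
    by (rule nested_sum_zeroD) (simp_all add: that \<Psi>)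
  then have 3: "\<Psi> $$ (r + x, s + y) = \<Psi> $$ (x, y)" if "x < r" "y < s" for x y
    using that by simp
  show ?thesis
    using 1 2 3 L \<Psi> by (intro half_bounded_bell_block [of \<Psi> r s]) (auto simp: rs)
qed

section \<open>Running a protocol backwards\<close>

lemma instr_carrier:
  assumes "is_instr d I" "i < length I"
  shows "set (kraus_ops I i) \<subseteq> carrier_mat (out_dim I i) d"
proof -
  have "(out_dim I i, kraus_ops I i) \<in> set I"
    using assms by (simp add: out_dim_def kraus_ops_def)
  then show ?thesis using assms(1) by (fastforce simp: is_instr_def)
qed

lemma in_set_kraus_concat:
  "K \<in> set (concat (map snd I)) \<longleftrightarrow> (\<exists>i<length I. K \<in> set (kraus_ops I i))"
  by (auto simp: kraus_ops_def in_set_conv_nth) (metis nth_mem snd_conv)+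

text \<open>One round in terms of ensembles: from left to right it drives the induction for
  necessity, from right to left it assembles protocols.\<close>

lemma restores_bell_Alice_iff:
  assumes "set L \<subseteq> carrier_mat a b"
  shows "restores_bell (Alice I P) a b (ens (a * b) L) \<longleftrightarrow> is_instr a I \<and>
    (\<forall>i<length I. restores_bell (P i) (out_dim I i) b
      (ens (out_dim I i * b) (concat (map (\<lambda>K. map ((*) K) L) (kraus_ops I i)))))"
  using apply_kraus_Alice [OF instr_carrier assms]
  by (fastforce simp: restores_bell_def)

lemma restores_bell_Bob_iff:
  assumes "set L \<subseteq> carrier_mat a b"
  shows "restores_bell (Bob I P) a b (ens (a * b) L) \<longleftrightarrow> is_instr b I \<and>
    (\<forall>i<length I. restores_bell (P i) a (out_dim I i)
      (ens (a * out_dim I i) (concat (map (\<lambda>K. map (\<lambda>\<Psi>. \<Psi> * K\<^sup>T) L) (kraus_ops I i)))))"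
  using apply_kraus_Bob [OF instr_carrier assms]
  by (fastforce simp: restores_bell_def)

text \<open>Induction on the protocol, with an arbitrary ensemble because a round turns one member
  into several. \<open>half_bounded_if_bell\<close> settles the final states, and
  \<open>half_bounded_pullback\<close> carries the bound back through each round.\<close>

lemma restores_bell_half_bounded:
  assumes "restores_bell P a b (ens (a * b) L)" "set L \<subseteq> carrier_mat a b" "\<Psi> \<in> set L"
  shows "half_bounded \<Psi>"
  using assms
proof (induction P arbitrary: a b L \<Psi>)
  case Stop
  then show ?case
    by (intro half_bounded_if_bell [of L a b]) (simp_all add: restores_bell_def)
next
  case (Alice I P)
  have I: "is_instr a I" using Alice.prems(1) by (simp add: restores_bell_def)
  have [simp]: "dim_row \<Psi> = a" using Alice.prems by auto
  have "half_bounded (K * \<Psi>)" if "i < length I" "K \<in> set (kraus_ops I i)" for i K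
  proof -
    let ?L = "concat (map (\<lambda>K. map ((*) K) L) (kraus_ops I i))"
    note carr = instr_carrier [OF I that(1)]
    have "restores_bell (P i) (out_dim I i) b (ens (out_dim I i * b) ?L)"
      using Alice.prems(1) that(1) by (simp add: restores_bell_Alice_iff [OF Alice.prems(2)])
    moreover have "set ?L \<subseteq> carrier_mat (out_dim I i) b"
      using carr Alice.prems(2) by fastforce
    moreover have "K * \<Psi> \<in> set ?L" using that Alice.prems(3) by auto
    ultimately show ?thesis by (rule Alice.IH [OF rangeI])
  qed
  \<comment> \<open>The Kraus operators of all outcomes together form one complete family.\<close>
  then show ?case
    by (intro half_bounded_pullback [of \<Psi> "concat (map snd I)"])
      (use instr_complete [OF I] in \<open>auto simp only: in_set_kraus_concat \<open>dim_row \<Psi> = a\<close>\<close>)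
next
  case (Bob I P)
  have I: "is_instr b I" using Bob.prems(1) by (simp add: restores_bell_def)
  have \<Psi>: "\<Psi> \<in> carrier_mat a b" using Bob.prems by auto
  have "half_bounded (K * \<Psi>\<^sup>T)" if "i < length I" "K \<in> set (kraus_ops I i)" for i K
  proof -
    let ?L = "concat (map (\<lambda>K. map (\<lambda>\<Psi>. \<Psi> * K\<^sup>T) L) (kraus_ops I i))"
    note carr = instr_carrier [OF I that(1)]
    have "restores_bell (P i) a (out_dim I i) (ens (a * out_dim I i) ?L)"
      using Bob.prems(1) that(1) by (simp add: restores_bell_Bob_iff [OF Bob.prems(2)])
    moreover have "set ?L \<subseteq> carrier_mat a (out_dim I i)"
      using carr Bob.prems(2) by fastforce
    moreover have "\<Psi> * K\<^sup>T \<in> set ?L" using that Bob.prems(3) by auto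
    ultimately have "half_bounded (\<Psi> * K\<^sup>T)" by (rule Bob.IH [OF rangeI])
    \<comment> \<open>Transposition swaps the parties, so that Bob's operator acts from the left and
      the same pullback applies.\<close>
    then have "half_bounded (\<Psi> * K\<^sup>T)\<^sup>T" by simp
    moreover have "K \<in> carrier_mat (out_dim I i) b" using carr that by auto
    ultimately show ?thesis using \<Psi> by (simp add: transpose_mult [of \<Psi> a b])
  qed
  moreover have "dim_row \<Psi>\<^sup>T = b" using \<Psi> by simp
  ultimately have "half_bounded \<Psi>\<^sup>T"
    by (intro half_bounded_pullback [of "\<Psi>\<^sup>T" "concat (map snd I)"])
      (use instr_complete [OF I] in \<open>auto simp only: in_set_kraus_concat\<close>)
  then show ?case by simp
qed

subsection \<open>Restoring a Bell pair from a state in Schmidt form\<close>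

text \<open>The state \<open>\<Sum>\<^sub>i a i |f i\<rangle>\<^sub>A |i\<rangle>\<^sub>B\<close>; its Schmidt form if \<open>f\<close> is injective.\<close>

definition diag_coeff :: "nat \<Rightarrow> (nat \<Rightarrow> nat) \<Rightarrow> (nat \<Rightarrow> complex) \<Rightarrow> complex mat" where
  "diag_coeff d f a = mat d 4 (\<lambda>(j, i). if j = f i then a i else 0)"

lemma diag_coeff_carrier [simp]: "diag_coeff d f a \<in> carrier_mat d 4"
  by (simp add: diag_coeff_def)

text \<open>The basis vectors \<open>f k\<close> and \<open>k\<close> as test vectors isolate
  \<open>a k\<close>; each column has its only possible nonzero entry \<open>a i\<close> in row
  \<open>f i\<close>, which gives the norm.\<close>

lemma half_bounded_diag_coeffD:
  assumes half: "half_bounded (diag_coeff d f a)" and f: "\<And>i. i < 4 \<Longrightarrow> f i < d" and "k < 4"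
  shows "(cmod (a k))\<^sup>2 \<le> 1 / 2 * (\<Sum>i<4. (cmod (a i))\<^sup>2)"
proof -
  have "nrm (diag_coeff d f a) = (\<Sum>i<4. \<Sum>j<d. if j = f i then (cmod (a i))\<^sup>2 else 0)"
    unfolding nrm_swap carrier_matD [OF diag_coeff_carrier]
    by (intro sum.cong refl) (simp add: diag_coeff_def)
  also have "\<dots> = (\<Sum>i<4. (cmod (a i))\<^sup>2)"
    using f by (intro sum.cong refl) simp
  finally have nrm: "nrm (diag_coeff d f a) = (\<Sum>i<4. (cmod (a i))\<^sup>2)" .
  have delta: "(\<Sum>i<n. (cmod (if i = l then 1 else 0))\<^sup>2) = 1" if "l < n" for l n :: nat
  proof -
    have "(\<Sum>i<n. (cmod (if i = l then 1 else 0))\<^sup>2) = (\<Sum>i<n. if i = l then 1 else 0)"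
      by (intro sum.cong refl) simp
    then show ?thesis using that by simp
  qed
  have "(\<Sum>i<d. \<Sum>j<4. (if i = f k then 1 else 0) * diag_coeff d f a $$ (i, j) * (if j = k then 1 else 0))
      = (\<Sum>i<d. if i = f k then a k else 0)"
    using \<open>k < 4\<close> by (intro sum.cong refl) (simp add: diag_coeff_def if_distrib [of "\<lambda>x. _ * x"] cong: if_cong)
  also have "\<dots> = a k" using f \<open>k < 4\<close> by simp
  finally show ?thesis
    using half [unfolded half_bounded_def, rule_format, of "\<lambda>i. if i = f k then 1 else 0" "\<lambda>j. if j = k then 1 else 0"]
      delta [of "f k" d] delta [of k 4] f [of k] \<open>k < 4\<close>
    by (simp add: nrm carrier_matD [OF diag_coeff_carrier])
qed

text \<open>The operator \<open>x |0\<rangle>\<langle>p| + y |1\<rangle>\<langle>q|\<close> into a qubit.\<close>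

definition qubit_op :: "nat \<Rightarrow> nat \<Rightarrow> complex \<Rightarrow> nat \<Rightarrow> complex \<Rightarrow> complex mat" where
  "qubit_op d p x q y = mat 2 d (\<lambda>(r, c). if r = 0 then if c = p then x else 0 else if c = q then y else 0)"

lemma qubit_op_carrier [simp]: "qubit_op d p x q y \<in> carrier_mat 2 d"
  by (simp add: qubit_op_def)

lemma qubit_op_dim [simp]: "dim_row (qubit_op d p x q y) = 2" "dim_col (qubit_op d p x q y) = d"
  by (simp_all add: qubit_op_def)

lemma sum_atLeastLessThan_2: "(\<Sum>r = 0..<2. h r) = h 0 + (h (Suc 0) :: 'a::comm_monoid_add)"
  by (simp add: numeral_2_eq_2)

text \<open>The two conditionals are added so that \<open>p = q\<close> is covered:
  \<open>qubit_op d l 1 l 0\<close> is |0><l|.\<close>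

lemma qubit_op_adjoint_mult:
  assumes "i < d" "j < d"
  shows "(mat_adjoint (qubit_op d p x q y) * qubit_op d p x q y) $$ (i, j)
    = (if i = j then (if i = p then of_real ((cmod x)\<^sup>2) else 0) + (if i = q then of_real ((cmod y)\<^sup>2) else 0) else 0)"
  using assms
  by (simp add: adjoint_eq qubit_op_def scalar_prod_def sum_atLeastLessThan_2
      complex_norm_square [unfolded of_real_power] mult.commute)

lemma qubit_op_mult:
  assumes "M \<in> carrier_mat d n" "p < d" "q < d" "r < 2" "c < n"
  shows "(qubit_op d p x q y * M) $$ (r, c) = (if r = 0 then x * M $$ (p, c) else y * M $$ (q, c))"
proof -
  have "(qubit_op d p x q y * M) $$ (r, c)
      = (\<Sum>l = 0..<d. (if r = 0 then if l = p then x else 0 else if l = q then y else 0) * M $$ (l, c))"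
    using assms by (simp add: qubit_op_def scalar_prod_def)
  also have "\<dots> = (\<Sum>l = 0..<d. if l = (if r = 0 then p else q)
      then (if r = 0 then x * M $$ (p, c) else y * M $$ (q, c)) else 0)"
    by (intro sum.cong refl) auto
  finally show ?thesis using assms by simp
qed

lemma mult_qubit_op_transpose:
  assumes "M \<in> carrier_mat m d" "p < d" "q < d" "r < m" "c < 2"
  shows "(M * (qubit_op d p x q y)\<^sup>T) $$ (r, c) = (if c = 0 then M $$ (r, p) * x else M $$ (r, q) * y)"
proof -
  have "M * (qubit_op d p x q y)\<^sup>T = (qubit_op d p x q y * M\<^sup>T)\<^sup>T"
    using assms by (simp add: transpose_mult [of _ 2 d])
  also have "\<dots> $$ (r, c) = (qubit_op d p x q y * M\<^sup>T) $$ (c, r)"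
    using assms by simp
  also have "\<dots> = (if c = 0 then M $$ (r, p) * x else M $$ (r, q) * y)"
    using assms by (subst qubit_op_mult [where n = m]) (auto simp: mult.commute)
  finally show ?thesis .
qed

text \<open>For completing an instrument: the operators |0><l| on the levels with \<open>Q\<close>
  contribute exactly the projection onto these levels.\<close>

lemma complement_adjoint_mult:
  assumes "i < d" "j < d"
  shows "(\<Sum>K \<leftarrow> map (\<lambda>l. qubit_op d l 1 l 0) (filter Q [0..<d]). (mat_adjoint K * K) $$ (i, j))
    = (if i = j \<and> Q i then 1 else 0)"
proof -
  have "(\<Sum>K \<leftarrow> map (\<lambda>l. qubit_op d l 1 l 0) (filter Q [0..<d]). (mat_adjoint K * K) $$ (i, j))
    = (\<Sum>l \<leftarrow> filter Q [0..<d]. if l = i then if i = j then 1 else 0 else 0)"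
    unfolding map_map comp_def qubit_op_adjoint_mult [OF assms]
    by (intro arg_cong [of _ _ sum_list] map_cong refl) simp
  also have "\<dots> = (\<Sum>l \<in> set (filter Q [0..<d]). if l = i then if i = j then 1 else 0 else 0)"
    by (rule sum_list_distinct_conv_sum_set) simp
  finally show ?thesis using assms by simp
qed

text \<open>Every member is a multiple of the Bell vector on two bare qubits; the remainders have
  dimension 1, and dividing by the trace gives the Bell projector.\<close>

lemma restores_bell_Stop:
  assumes L: "set L \<subseteq> carrier_mat 2 2"
    and bal: "\<And>\<Phi>. \<Phi> \<in> set L \<Longrightarrow> \<Phi> $$ (0, 1) = 0 \<and> \<Phi> $$ (1, 0) = 0 \<and> \<Phi> $$ (1, 1) = \<Phi> $$ (0, 0)"
  shows "restores_bell Stop 2 2 (ens (2 * 2) L)"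
proof -
  define t where "t = (\<Sum>\<Phi> \<leftarrow> L. (cmod (\<Phi> $$ (0, 0)))\<^sup>2)"
  have "nrm \<Phi> = 2 * (cmod (\<Phi> $$ (0, 0)))\<^sup>2" if "\<Phi> \<in> set L" for \<Phi>
    using bal [OF that] L that
    by (auto simp: nrm_def lessThan_atLeast0 sum_atLeastLessThan_2)
  then have "(\<Sum>\<Phi> \<leftarrow> L. nrm \<Phi>) = (\<Sum>\<Phi> \<leftarrow> L. 2 * (cmod (\<Phi> $$ (0, 0)))\<^sup>2)"
    by (intro arg_cong [of _ _ sum_list] map_cong refl)
  then have tr: "mtrace (ens (2 * 2) L) = complex_of_real (2 * t)"
    unfolding mtrace_ens [OF L] t_def by (simp add: sum_list_const_mult)
  have red: "reduce_AB 1 1 (ens (2 * 2) L) $$ (i, j) = complex_of_real (2 * t) * proj bell $$ (i, j)"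
    if "i < 4" "j < 4" for i j
  proof -
    have 1: "\<Phi> $$ (i div 2, i mod 2) = (if i \<in> {0, 3} then \<Phi> $$ (0, 0) else 0)" if "\<Phi> \<in> set L" "i < 4" for \<Phi> i
    proof -
      have "i = 0 \<or> i = 1 \<or> i = 2 \<or> i = 3" using that by auto
      then show ?thesis using bal [OF that(1)] by auto
    qed
    have "reduce_AB 1 1 (ens (2 * 2) L) $$ (i, j)
        = (\<Sum>\<Phi> \<leftarrow> L. \<Phi> $$ (i div 2, i mod 2) * cnj (\<Phi> $$ (j div 2, j mod 2)))"
      using reduce_AB_ens [of L 1 1 i j] L that by simp
    also have "\<dots> = (\<Sum>\<Phi> \<leftarrow> L. if i \<in> {0, 3} \<and> j \<in> {0, 3} then complex_of_real ((cmod (\<Phi> $$ (0, 0)))\<^sup>2) else 0)"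
      using that by (intro arg_cong [of _ _ sum_list] map_cong refl)
        (simp add: 1 complex_norm_square [unfolded of_real_power])
    also have "\<dots> = complex_of_real (2 * t) * proj bell $$ (i, j)"
      using that by (simp add: proj_bell_index t_def of_real_sum_list)
    finally show ?thesis .
  qed
  \<comment> \<open>The case \<open>t = 0\<close> has probability zero, where nothing is
    demanded.\<close>
  have "(1 / complex_of_real (2 * t)) \<cdot>\<^sub>m reduce_AB 1 1 (ens (2 * 2) L) = proj bell" if "t \<noteq> 0"
  proof (rule eq_matI)
    have dim: "dim_vec bell = 4" by (simp add: bell_def)
    fix i j assume "i < dim_row (proj bell)" "j < dim_col (proj bell)"
    then have ij: "i < 4" "j < 4" by (simp_all add: proj_def dim)
    moreover have "dim_row (reduce_AB 1 1 (ens (2 * 2) L)) = 4" "dim_col (reduce_AB 1 1 (ens (2 * 2) L)) = 4"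
      by (simp_all add: reduce_AB_def)
    ultimately have "((1 / complex_of_real (2 * t)) \<cdot>\<^sub>m reduce_AB 1 1 (ens (2 * 2) L)) $$ (i, j)
      = (1 / complex_of_real (2 * t)) * (reduce_AB 1 1 (ens (2 * 2) L) $$ (i, j))"
      by (intro index_smult_mat) simp_all
    also have "\<dots> = proj bell $$ (i, j)"
      unfolding red [OF ij] using that by simp
    finally show "((1 / complex_of_real (2 * t)) \<cdot>\<^sub>m reduce_AB 1 1 (ens (2 * 2) L)) $$ (i, j) = proj bell $$ (i, j)" .
  qed (simp_all add: reduce_AB_def proj_def bell_def)
  then show ?thesis
    by (simp only: restores_bell_def valid.simps final_branches.simps singleton_iff ball_simps split_conv)
       (simp add: tr [simplified])
qed

text \<open>Bob's part of the protocol. Alice has sent \<open>p\<close> to 0 and \<open>q\<close> to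
  1, leaving z (|0>|p> + |1>|q>), and Bob relabels in the same way. His other operators annihilate
  the state and only complete the instrument, so one outcome suffices; z may depend on the member
  and may be 0.\<close>

lemma qubit_pair_restorable:
  assumes pq: "p < 4" "q < 4" "p \<noteq> q"
    and L: "\<And>\<Phi>. \<Phi> \<in> set L \<Longrightarrow> \<exists>z. \<Phi> = qubit_op 4 p z q z"
  shows "\<exists>P. restores_bell P 2 4 (ens (2 * 4) L)"
proof -
  define Ks where "Ks = qubit_op 4 p 1 q 1 # map (\<lambda>j. qubit_op 4 j 1 j 0) (filter (\<lambda>j. j \<noteq> p \<and> j \<noteq> q) [0..<4])"
  have carr: "set L \<subseteq> carrier_mat 2 4" using L qubit_op_carrier by fastforce
  have Ks: "set Ks \<subseteq> carrier_mat 2 4" by (auto simp: Ks_def)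
  have "(\<Sum>K \<leftarrow> Ks. (mat_adjoint K * K) $$ (i, j)) = (if i = j then 1 else 0)" if "i < 4" "j < 4" for i j
    unfolding Ks_def list.map sum_list.Cons complement_adjoint_mult [OF that] qubit_op_adjoint_mult [OF that]
    using pq by auto
  then have "is_instr 4 [(2, Ks)]"
    using Ks by (auto simp: is_instr_def intro!: eq_matI)
  moreover have "restores_bell Stop 2 2 (ens (2 * 2) (concat (map (\<lambda>K. map (\<lambda>\<Phi>. \<Phi> * K\<^sup>T) L) Ks)))"
  proof (rule restores_bell_Stop)
    show "set (concat (map (\<lambda>K. map (\<lambda>\<Phi>. \<Phi> * K\<^sup>T) L) Ks)) \<subseteq> carrier_mat 2 2"
      using Ks carr by fastforce
    fix \<Phi> assume "\<Phi> \<in> set (concat (map (\<lambda>K. map (\<lambda>\<Phi>. \<Phi> * K\<^sup>T) L) Ks))"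
    then obtain K \<Phi>' where K: "K \<in> set Ks" and \<Phi>': "\<Phi>' \<in> set L" and \<Phi>: "\<Phi> = \<Phi>' * K\<^sup>T" by auto
    obtain z where z: "\<Phi>' = qubit_op 4 p z q z" using L [OF \<Phi>'] by auto
    have z': "qubit_op 4 p z q z \<in> carrier_mat 2 4" by simp
    from K consider "K = qubit_op 4 p 1 q 1" | j where "K = qubit_op 4 j 1 j 0" "j < 4" "j \<noteq> p" "j \<noteq> q"
      by (auto simp: Ks_def)
    then show "\<Phi> $$ (0, 1) = 0 \<and> \<Phi> $$ (1, 0) = 0 \<and> \<Phi> $$ (1, 1) = \<Phi> $$ (0, 0)"
      using pq unfolding \<Phi> z
      by cases (simp_all add: mult_qubit_op_transpose [OF z'] del: One_nat_def index_mult_mat(1),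
          simp_all add: qubit_op_def)
  qed
  ultimately have "restores_bell (Bob [(2, Ks)] (\<lambda>_. Stop)) 2 4 (ens (2 * 4) L)"
    unfolding restores_bell_Bob_iff [OF carr] by (simp add: out_dim_def kraus_ops_def)
  then show ?thesis by blast
qed

lemma cmod_sqrt_div_power2:
  assumes "0 \<le> w"
  shows "(cmod (complex_of_real (sqrt w) / a))\<^sup>2 = w / (cmod a)\<^sup>2"
  using assms by (simp add: norm_divide power_divide)

text \<open>
  The three hypotheses are nonnegativity of the weights of the pairs \<open>{1,2}\<close>, \<open>{0,2}\<close> and
  \<open>{0,1}\<close>; level \<open>3\<close> is paired with level \<open>0\<close> only.
\<close>

lemma diag_coeff_restorable:
  assumes inj: "inj_on f {..<4}" and f: "\<And>i. i < 4 \<Longrightarrow> f i < d"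
    and a: "\<And>i. i < 4 \<Longrightarrow> a i \<noteq> 0"
    and le1: "(cmod (a 0))\<^sup>2 \<le> (cmod (a 1))\<^sup>2 + (cmod (a 2))\<^sup>2 + (cmod (a 3))\<^sup>2"
    and le2: "(cmod (a 1))\<^sup>2 + (cmod (a 3))\<^sup>2 \<le> (cmod (a 0))\<^sup>2 + (cmod (a 2))\<^sup>2"
    and le3: "(cmod (a 2))\<^sup>2 + (cmod (a 3))\<^sup>2 \<le> (cmod (a 0))\<^sup>2 + (cmod (a 1))\<^sup>2"
  shows "\<exists>P. restores_bell P d 4 (ens (d * 4) [diag_coeff d f a])"
proof -
  define l where "l i = (cmod (a i))\<^sup>2" for i
  have l: "l i > 0" if "i < 4" for i using a that by (simp add: l_def)
  \<comment> \<open>Pairing level 3 with level 0 uses up \<open>l 3\<close> on both; the other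
    weights are the unique solution of the remaining three-level problem for
    \<open>l 0 - l 3\<close>, \<open>l 1\<close>, \<open>l 2\<close>.\<close>
  define S :: "(nat \<times> nat \<times> real) list" where "S = [(0, 1, (l 0 + l 1 - l 2 - l 3) / 2), (0, 2, (l 0 + l 2 - l 1 - l 3) / 2),
    (0, 3, l 3), (1, 2, (l 1 + l 2 + l 3 - l 0) / 2)]"
  have S: "p < 4 \<and> q < 4 \<and> p \<noteq> q \<and> 0 \<le> w" if "(p, q, w) \<in> set S" for p q w
    using that le1 le2 le3 by (auto simp: S_def l_def)
  \<comment> \<open>Dividing by the complex amplitude instead of its modulus also cancels phases, so
    both levels end with amplitude \<open>sqrt w\<close>.\<close>
  define K where "K = (\<lambda>(p, q, w). qubit_op d (f p) (of_real (sqrt w) / a p) (f q) (of_real (sqrt w) / a q))"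
  \<comment> \<open>Levels outside the range of \<open>f\<close> carry no amplitude; these operators
    serve completeness only.\<close>
  define Ns where "Ns = map (\<lambda>j. qubit_op d j 1 j 0) (filter (\<lambda>j. j \<notin> f ` {..<4}) [0..<d])"
  define I where "I = map (\<lambda>s. (2, [K s])) S @ [(2 :: nat, Ns)]"
  define \<Psi> where "\<Psi> = diag_coeff d f a"
  have \<Psi>: "\<Psi> \<in> carrier_mat d 4" by (simp add: \<Psi>_def)
  have KK: "(mat_adjoint (K (p, q, w)) * K (p, q, w)) $$ (i, j)
    = (if i = j then (if i = f p then of_real (w / l p) else 0) + (if i = f q then of_real (w / l q) else 0) else 0)"
    if "(p, q, w) \<in> set S" "i < d" "j < d" for p q w i j
    using S [OF that(1)] unfolding K_def split_conv qubit_op_adjoint_mult [OF that(2,3)]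
    by (simp only: cmod_sqrt_div_power2 l_def)
  have sum: "(\<Sum>(e, Ks) \<leftarrow> I. \<Sum>M \<leftarrow> Ks. (mat_adjoint M * M) $$ (i, j)) = (if i = j then 1 else 0)"
    if ij: "i < d" "j < d" for i j
  proof -
    have "(\<Sum>(e, Ks) \<leftarrow> I. \<Sum>M \<leftarrow> Ks. (mat_adjoint M * M) $$ (i, j))
      = (\<Sum>s \<leftarrow> S. (mat_adjoint (K s) * K s) $$ (i, j)) + (if i = j \<and> i \<notin> f ` {..<4} then 1 else 0)"
      unfolding I_def map_append sum_list_append Ns_def
      using complement_adjoint_mult [OF ij] by (simp add: comp_def)
    also have "(\<Sum>s \<leftarrow> S. (mat_adjoint (K s) * K s) $$ (i, j))
      = (\<Sum>(p, q, w) \<leftarrow> S. if i = j then (if i = f p then of_real (w / l p) else 0) + (if i = f q then of_real (w / l q) else 0) else 0)"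
      using KK ij by (intro arg_cong [of _ _ sum_list] map_cong refl) auto
    also have "\<dots> = (if i = j \<and> i \<in> f ` {..<4} then 1 else 0)"
    proof (cases "i = j \<and> i \<in> f ` {..<4}")
      case False
      then have "(\<Sum>(p, q, w) \<leftarrow> S. if i = j then (if i = f p then complex_of_real (w / l p) else 0)
          + (if i = f q then of_real (w / l q) else 0) else 0) = (\<Sum>s \<leftarrow> S. 0)"
        using S by (intro arg_cong [of _ _ sum_list] map_cong refl) auto
      then show ?thesis using False by simp
    next
      case True
      then obtain k where k: "k < 4" "i = f k" by auto
      have eq: "i = f p \<longleftrightarrow> p = k" if "p < 4" for p
        using inj k that by (auto dest: inj_onD)
      have "(\<Sum>(p, q, w) \<leftarrow> S. if i = j then (if i = f p then complex_of_real (w / l p) else 0)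
          + (if i = f q then of_real (w / l q) else 0) else 0)
        = (\<Sum>(p, q, w) \<leftarrow> S. complex_of_real ((if p = k then w / l p else 0) + (if q = k then w / l q else 0)))"
        using S True eq by (intro arg_cong [of _ _ sum_list] map_cong refl) auto
      also have "\<dots> = complex_of_real (\<Sum>(p, q, w) \<leftarrow> S. (if p = k then w / l p else 0) + (if q = k then w / l q else 0))"
        by (simp only: of_real_sum_list case_prod_unfold)
      \<comment> \<open>The weights of the pairs containing \<open>k\<close> add up to
        \<open>l k\<close>.\<close>
      also have "(\<Sum>(p, q, w) \<leftarrow> S. (if p = k then w / l p else 0) + (if q = k then w / l q else 0)) = 1"
      proof -
        have "k = 0 \<or> k = 1 \<or> k = 2 \<or> k = 3" using k by auto
        then show ?thesis
          using l [of 0] l [of 1] l [of 2] l [of 3] by (elim disjE) (simp_all add: S_def field_simps)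
      qed
      finally show ?thesis by (simp only: if_P [OF True] of_real_1)
    qed
    finally show ?thesis by auto
  qed
  have "is_instr d I"
  proof -
    have "\<forall>(e, Ks) \<in> set I. 0 < e \<and> set Ks \<subseteq> carrier_mat e d"
      by (auto simp: I_def K_def Ns_def)
    moreover have "mat d d (\<lambda>ij. \<Sum>(e, Ks) \<leftarrow> I. \<Sum>M \<leftarrow> Ks. (mat_adjoint M * M) $$ ij) = 1\<^sub>m d"
      by (rule eq_matI) (simp_all add: sum)
    ultimately show ?thesis by (simp add: is_instr_def)
  qed
  moreover have "\<exists>P. restores_bell P (out_dim I i) 4
      (ens (out_dim I i * 4) (concat (map (\<lambda>K. map ((*) K) [\<Psi>]) (kraus_ops I i))))" if "i < length I" for i
  proof -
    from that have "I ! i \<in> set I" by simp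
    then consider p q w where "(p, q, w) \<in> set S" "I ! i = (2, [K (p, q, w)])" | "I ! i = (2, Ns)"
      by (auto simp: I_def)
    then show ?thesis
    proof cases
      case 1
      have "K (p, q, w) * \<Psi> = qubit_op 4 p (of_real (sqrt w)) q (of_real (sqrt w))"
      proof (rule eq_matI)
        fix r c assume "r < dim_row (qubit_op 4 p (of_real (sqrt w)) q (of_real (sqrt w)))"
          "c < dim_col (qubit_op 4 p (of_real (sqrt w)) q (of_real (sqrt w)))"
        then have rc: "r < 2" "c < 4" by simp_all
        have pq: "p < 4" "q < 4" using S [OF 1(1)] by auto
        have eq: "f x = f c \<longleftrightarrow> c = x" if "x < 4" for x
          using inj rc that by (auto dest: inj_onD)
        have "(K (p, q, w) * \<Psi>) $$ (r, c) = (if r = 0 then of_real (sqrt w) / a p * \<Psi> $$ (f p, c) else of_real (sqrt w) / a q * \<Psi> $$ (f q, c))"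
          unfolding K_def split_conv by (rule qubit_op_mult [OF \<Psi>]) (use f pq rc in auto)
        also have "\<dots> = qubit_op 4 p (of_real (sqrt w)) q (of_real (sqrt w)) $$ (r, c)"
          using rc f pq a by (simp add: \<Psi>_def diag_coeff_def qubit_op_def eq)
        finally show "(K (p, q, w) * \<Psi>) $$ (r, c) = qubit_op 4 p (of_real (sqrt w)) q (of_real (sqrt w)) $$ (r, c)" .
      qed (simp_all add: K_def \<Psi>_def diag_coeff_def)
      then show ?thesis
        using S [OF 1(1)] qubit_pair_restorable [of p q "[K (p, q, w) * \<Psi>]"] 1(2)
        by (auto simp: out_dim_def kraus_ops_def)
    next
      case 2
      \<comment> \<open>The zero matrix, written with z = 0 in the form that
        \<open>qubit_pair_restorable\<close> expects.\<close>
      have "N * \<Psi> = qubit_op 4 0 0 1 0" if "N \<in> set Ns" for N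
      proof -
        from that obtain j where j: "N = qubit_op d j 1 j 0" "j < d" "j \<notin> f ` {..<4}"
          by (auto simp: Ns_def)
        show ?thesis
        proof (rule eq_matI)
          fix r c assume "r < dim_row (qubit_op 4 0 0 1 0)" "c < dim_col (qubit_op 4 0 0 1 0)"
          then have rc: "r < 2" "c < 4" by simp_all
          have "(N * \<Psi>) $$ (r, c) = (if r = 0 then 1 * \<Psi> $$ (j, c) else 0 * \<Psi> $$ (j, c))"
            unfolding j(1) by (rule qubit_op_mult [OF \<Psi>]) (use j rc in auto)
          then show "(N * \<Psi>) $$ (r, c) = qubit_op 4 0 0 1 0 $$ (r, c)"
            using rc j by (auto simp: \<Psi>_def diag_coeff_def qubit_op_def)
        qed (simp_all add: j \<Psi>_def diag_coeff_def)
      qed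
      then have "\<exists>P. restores_bell P 2 4 (ens (2 * 4) (concat (map (\<lambda>K. map ((*) K) [\<Psi>]) Ns)))"
        by (intro qubit_pair_restorable [of 0 1]) auto
      then show ?thesis using 2 by (simp add: out_dim_def kraus_ops_def)
    qed
  qed
  then obtain P where "\<forall>i<length I. restores_bell (P i) (out_dim I i) 4
      (ens (out_dim I i * 4) (concat (map (\<lambda>K. map ((*) K) [\<Psi>]) (kraus_ops I i))))"
    by metis
  ultimately have "restores_bell (Alice I P) d 4 (ens (d * 4) [\<Psi>])"
    by (subst restores_bell_Alice_iff) (simp_all add: \<Psi>)
  then show ?thesis unfolding \<Psi>_def by blast
qed

subsection \<open>The initial state in the two models\<close>

text \<open>Amplitude of \<open>|aa\<rangle>\<^sub>A\<^sub>B |kkk\<rangle>\<^sub>A\<^sub>'\<^sub>B\<^sub>'\<^sub>K\<close> for \<open>i = 2 a + k\<close>.\<close>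

definition amp :: "real \<Rightarrow> real \<Rightarrow> real \<Rightarrow> nat \<Rightarrow> complex" where
  "amp \<theta> \<alpha> \<beta> i = of_real ((if i < 2 then cos \<theta> else sin \<theta>) * (if even i then \<alpha> else \<beta>))"

lemma kron_vec_index:
  assumes "i < dim_vec u" "j < dim_vec v"
  shows "kron_vec u v $ (dim_vec v * i + j) = u $ i * v $ j"
proof -
  have nz: "dim_vec v \<noteq> 0" using assms(2) by linarith
  have "dim_vec v * i + j < dim_vec v * Suc i" using assms by simp
  also have "\<dots> \<le> dim_vec v * dim_vec u" using assms by (intro mult_left_mono) simp_all
  finally have "dim_vec v * i + j < dim_vec u * dim_vec v" by (simp only: mult.commute)
  moreover have "(dim_vec v * i + j) div dim_vec v = i" "(dim_vec v * i + j) mod dim_vec v = j"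
    unfolding div_mult_self4 [OF nz] using assms(2) by simp_all
  ultimately show ?thesis by (simp add: kron_vec_def)
qed

lemma amplitude_eq:
  assumes "a < 2" "b < 2" "a' < 2" "b' < 2" "k < 2"
  shows "amplitude \<theta> \<alpha> \<beta> a b a' b' k = (if a = b \<and> a' = b' \<and> a' = k then amp \<theta> \<alpha> \<beta> (2 * a + k) else 0)"
proof -
  have bit: "n = 0 \<or> n = 1" if "n < 2" for n :: nat using that by auto
  have dim: "dim_vec (link \<theta>) = 4" "dim_vec (ghz \<alpha> \<beta>) = 8" by (simp_all add: link_def ghz_def)
  have "link \<theta> $ (2 * a + b) = (if a = b then of_real (if a = 0 then cos \<theta> else sin \<theta>) else 0)"
    using bit [OF assms(1)] bit [OF assms(2)]
    by (elim disjE) (simp_all add: link_def numeral_eq_Suc)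
  moreover have "ghz \<alpha> \<beta> $ (4 * a' + 2 * b' + k)
      = (if a' = b' \<and> a' = k then of_real (if k = 0 then \<alpha> else \<beta>) else 0)"
    using bit [OF assms(3)] bit [OF assms(4)] bit [OF assms(5)]
    by (elim disjE) (simp_all add: ghz_def numeral_eq_Suc)
  moreover have "16 * a + 8 * b + 4 * a' + 2 * b' + k = 8 * (2 * a + b) + (4 * a' + 2 * b' + k)" by simp
  ultimately have "amplitude \<theta> \<alpha> \<beta> a b a' b' k = (if a = b then of_real (if a = 0 then cos \<theta> else sin \<theta>) else 0)
      * (if a' = b' \<and> a' = k then of_real (if k = 0 then \<alpha> else \<beta>) else 0)"
    using kron_vec_index [of "2 * a + b" "link \<theta>" "4 * a' + 2 * b' + k" "ghz \<alpha> \<beta>"] assms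
    by (simp only: amplitude_def initial_def dim)
  also have "\<dots> = (if a = b \<and> a' = b' \<and> a' = k then amp \<theta> \<alpha> \<beta> (2 * a + k) else 0)"
    using bit [OF assms(1)] bit [OF assms(2)] bit [OF assms(5)] by (elim disjE) (simp_all add: amp_def)
  finally show ?thesis .
qed

text \<open>For checking index identities in small fixed dimensions case by case.\<close>

lemma all_less_numeral:
  "(\<forall>i<numeral k. P i) \<longleftrightarrow> P (pred_numeral k) \<and> (\<forall>i<pred_numeral k. P i)"
  by (simp add: numeral_eq_Suc All_less_Suc)

lemmas enumerate_less = all_less_numeral pred_numeral_simps Num.BitM.simps not_less_zero simp_thms

lemma sum_lessThan_4: "(\<Sum>i<4 :: nat. h i) = h 0 + h 1 + h 2 + (h 3 :: 'a::comm_monoid_add)"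
  by (simp add: eval_nat_numeral)

lemma cmod_amp:
  "(cmod (amp \<theta> \<alpha> \<beta> i))\<^sup>2 = (if i < 2 then (cos \<theta>)\<^sup>2 else (sin \<theta>)\<^sup>2) * (if even i then \<alpha>\<^sup>2 else \<beta>\<^sup>2)"
  by (simp only: amp_def norm_of_real power2_abs power_mult_distrib) simp

text \<open>
  Coefficients of the cut \<open>K\<close> versus \<open>A A' B B'\<close>: the column of \<open>a a' b b'\<close> with \<open>a = b\<close> and
  \<open>a' = b' = k\<close> is \<open>10 a + 5 k\<close>.
\<close>

definition bank_coeff :: "real \<Rightarrow> real \<Rightarrow> real \<Rightarrow> complex mat" where
  "bank_coeff \<theta> \<alpha> \<beta> = mat 2 16 (\<lambda>(k, l).
     if l = 5 * k then amp \<theta> \<alpha> \<beta> k else if l = 10 + 5 * k then amp \<theta> \<alpha> \<beta> (2 + k) else 0)"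

lemma initial_KAB_flat: "initial_KAB \<theta> \<alpha> \<beta> = flat (bank_coeff \<theta> \<alpha> \<beta>)"
proof (rule eq_vecI)
  fix i assume "i < dim_vec (flat (bank_coeff \<theta> \<alpha> \<beta>))"
  then have "i < 32" by (simp add: bank_coeff_def)
  moreover have "\<forall>i<32. initial_KAB \<theta> \<alpha> \<beta> $ i = flat (bank_coeff \<theta> \<alpha> \<beta>) $ i"
    by (simp only: enumerate_less)
      (simp add: initial_KAB_def flat_def bank_coeff_def amplitude_eq)
  ultimately show "initial_KAB \<theta> \<alpha> \<beta> $ i = flat (bank_coeff \<theta> \<alpha> \<beta>) $ i" by blast
qed (simp add: initial_KAB_def bank_coeff_def)

text \<open>Position of \<open>a a' k\<close> with \<open>a' = k\<close> in Alice's system, for \<open>i = 2 a + k\<close>.\<close>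

definition transfer_index :: "nat \<Rightarrow> nat" where
  "transfer_index i = 4 * (i div 2) + 3 * (i mod 2)"

lemma initial_transfer_flat:
  "initial_transfer \<theta> \<alpha> \<beta> = flat (diag_coeff 8 transfer_index (amp \<theta> \<alpha> \<beta>))"
proof (rule eq_vecI)
  fix i assume "i < dim_vec (flat (diag_coeff 8 transfer_index (amp \<theta> \<alpha> \<beta>)))"
  then have "i < 32" by (simp add: diag_coeff_def)
  moreover have "\<forall>i<32. initial_transfer \<theta> \<alpha> \<beta> $ i = flat (diag_coeff 8 transfer_index (amp \<theta> \<alpha> \<beta>)) $ i"
    by (simp only: enumerate_less)
      (simp add: initial_transfer_def flat_def diag_coeff_def transfer_index_def amplitude_eq)
  ultimately show "initial_transfer \<theta> \<alpha> \<beta> $ i = flat (diag_coeff 8 transfer_index (amp \<theta> \<alpha> \<beta>)) $ i" by blast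
qed (simp add: initial_transfer_def diag_coeff_def)

lemma proj_flat: "\<Psi> \<in> carrier_mat a b \<Longrightarrow> proj (flat \<Psi>) = ens (a * b) [\<Psi>]"
  by (rule eq_matI) (auto simp: ens_def proj_def)

text \<open>Unnormalised state of A A' and B B' when the Bank applies \<open>M\<close> and its
  output is in basis state \<open>k\<close>. The value of \<open>K\<close> belonging to level
  \<open>l\<close> is the last bit of \<open>l\<close>, and level \<open>l\<close> has position
  \<open>l\<close> on both sides, hence \<open>id\<close>.\<close>

definition bank_branch :: "real \<Rightarrow> real \<Rightarrow> real \<Rightarrow> complex mat \<Rightarrow> nat \<Rightarrow> complex mat" where
  "bank_branch \<theta> \<alpha> \<beta> M k = diag_coeff 4 id (\<lambda>l. M $$ (k, l mod 2) * amp \<theta> \<alpha> \<beta> l)"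

lemma bank_branch_index:
  assumes "M \<in> carrier_mat e 2" "k < e" "i < 16"
  shows "(M * bank_coeff \<theta> \<alpha> \<beta>) $$ (k, i) = bank_branch \<theta> \<alpha> \<beta> M k $$ (i div 4, i mod 4)"
proof -
  have "(M * bank_coeff \<theta> \<alpha> \<beta>) $$ (k, i)
      = M $$ (k, 0) * bank_coeff \<theta> \<alpha> \<beta> $$ (0, i) + M $$ (k, 1) * bank_coeff \<theta> \<alpha> \<beta> $$ (1, i)"
    using assms by (simp add: bank_coeff_def scalar_prod_def sum_atLeastLessThan_2)
  moreover have "\<forall>i<16. M $$ (k, 0) * bank_coeff \<theta> \<alpha> \<beta> $$ (0, i) + M $$ (k, 1) * bank_coeff \<theta> \<alpha> \<beta> $$ (1, i)
      = bank_branch \<theta> \<alpha> \<beta> M k $$ (i div 4, i mod 4)"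
    by (simp only: enumerate_less) (simp add: bank_coeff_def bank_branch_def diag_coeff_def)
  ultimately show ?thesis using assms(3) by simp
qed

text \<open>Tracing out the Bank's system amounts to measuring it in the computational basis and
  forgetting the result, so each Kraus operator contributes one pure member per basis state.\<close>

lemma after_bank_ens:
  assumes I: "is_instr 2 I" and i: "i < length I"
  shows "after_bank \<theta> \<alpha> \<beta> I i = ens (4 * 4) (concat (map (\<lambda>M. map (bank_branch \<theta> \<alpha> \<beta> M) [0..<out_dim I i]) (kraus_ops I i)))"
    (is "_ = ens _ ?L")
proof -
  define e where "e = out_dim I i"
  have carr: "set (kraus_ops I i) \<subseteq> carrier_mat e 2" unfolding e_def by (rule instr_carrier [OF I i])
  have B: "bank_coeff \<theta> \<alpha> \<beta> \<in> carrier_mat 2 16" by (simp add: bank_coeff_def)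
  then have B': "set [bank_coeff \<theta> \<alpha> \<beta>] \<subseteq> carrier_mat 2 16" by simp
  define L where "L = map (\<lambda>M. M * bank_coeff \<theta> \<alpha> \<beta>) (kraus_ops I i)"
  have L: "set L \<subseteq> carrier_mat e 16" using carr B by (auto simp: L_def)
  have L2: "set ?L \<subseteq> carrier_mat 4 4" by (auto simp: bank_branch_def)
  have conc: "concat (map (\<lambda>M. [M * bank_coeff \<theta> \<alpha> \<beta>]) Ms) = map (\<lambda>M. M * bank_coeff \<theta> \<alpha> \<beta>) Ms" for Ms
    by (induction Ms) simp_all
  have "after_bank \<theta> \<alpha> \<beta> I i = trace_left e 16 (ens (e * 16) L)"
    using apply_kraus_Alice [OF carr B']
    by (simp add: after_bank_def e_def [symmetric] initial_KAB_flat proj_flat [OF B] L_def conc)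
  also have "\<dots> = ens (4 * 4) ?L"
  proof (rule eq_matI)
    fix x y assume "x < dim_row (ens (4 * 4) ?L)" "y < dim_col (ens (4 * 4) ?L)"
    then have xy: "x < 16" "y < 16" by (simp_all add: ens_def)
    have "trace_left e 16 (ens (e * 16) L) $$ (x, y) = (\<Sum>k<e. ens (e * 16) L $$ (k * 16 + x, k * 16 + y))"
      using xy by (simp add: trace_left_def)
    also have "\<dots> = (\<Sum>k<e. \<Sum>\<Psi> \<leftarrow> L. \<Psi> $$ (k, x) * cnj (\<Psi> $$ (k, y)))"
    proof (rule sum.cong [OF refl])
      fix k assume "k \<in> {..<e}"
      then have "k * 16 + x < e * 16" "k * 16 + y < e * 16" using xy by auto
      then show "ens (e * 16) L $$ (k * 16 + x, k * 16 + y) = (\<Sum>\<Psi> \<leftarrow> L. \<Psi> $$ (k, x) * cnj (\<Psi> $$ (k, y)))"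
        using xy by (subst ens_index [OF L]) simp_all
    qed
    also have "\<dots> = (\<Sum>\<Psi> \<leftarrow> L. \<Sum>k<e. \<Psi> $$ (k, x) * cnj (\<Psi> $$ (k, y)))"
      by (rule sum_list_sum_swap [symmetric])
    also have "\<dots> = (\<Sum>M \<leftarrow> kraus_ops I i. \<Sum>k<e. bank_branch \<theta> \<alpha> \<beta> M k $$ (x div 4, x mod 4)
        * cnj (bank_branch \<theta> \<alpha> \<beta> M k $$ (y div 4, y mod 4)))"
      unfolding L_def map_map comp_def
      using carr by (intro arg_cong [of _ _ sum_list] map_cong sum.cong refl)
        (auto simp: bank_branch_index [OF _ _ xy(1)] bank_branch_index [OF _ _ xy(2)] simp del: index_mult_mat(1))
    also have "\<dots> = (\<Sum>\<Phi> \<leftarrow> ?L. \<Phi> $$ (x div 4, x mod 4) * cnj (\<Phi> $$ (y div 4, y mod 4)))"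
    proof -
      have "(\<Sum>M \<leftarrow> Ms. \<Sum>k<e. g (bank_branch \<theta> \<alpha> \<beta> M k))
        = (\<Sum>\<Phi> \<leftarrow> concat (map (\<lambda>M. map (bank_branch \<theta> \<alpha> \<beta> M) [0..<e]) Ms). g \<Phi>)"
        for g :: "complex mat \<Rightarrow> complex" and Ms
        by (induction Ms) (simp_all add: comp_def interv_sum_list_conv_sum_set_nat lessThan_atLeast0)
      then show ?thesis unfolding e_def .
    qed
    also have "\<dots> = ens (4 * 4) ?L $$ (x, y)"
      using xy by (subst ens_index [OF L2]) simp_all
    finally show "trace_left e 16 (ens (e * 16) L) $$ (x, y) = ens (4 * 4) ?L $$ (x, y)" .
  qed (simp_all add: trace_left_def ens_def)
  finally show ?thesis .
qed

lemma cmod_amp_sum: "(\<Sum>i<4. (cmod (amp \<theta> \<alpha> \<beta> i))\<^sup>2) = \<alpha>\<^sup>2 + \<beta>\<^sup>2"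
proof -
  have "(\<Sum>i<4. (cmod (amp \<theta> \<alpha> \<beta> i))\<^sup>2) = (\<alpha>\<^sup>2 + \<beta>\<^sup>2) * ((cos \<theta>)\<^sup>2 + (sin \<theta>)\<^sup>2)"
    by (simp add: cmod_amp sum_lessThan_4 algebra_simps del: sin_cos_squared_add sin_cos_squared_add2)
  then show ?thesis by simp
qed

lemma transfer_index_less:
  assumes "i < 4"
  shows "transfer_index i < 8"
proof -
  have "\<forall>i<4. transfer_index i < 8"
    by (simp only: enumerate_less) (simp add: transfer_index_def)
  then show ?thesis using assms by blast
qed

lemma inj_transfer_index: "inj_on transfer_index {..<4}"
proof -
  have "\<forall>i<4. \<forall>j<4. transfer_index i = transfer_index j \<longrightarrow> i = j"
    by (simp only: enumerate_less) (simp add: transfer_index_def)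
  then show ?thesis by (auto simp: inj_on_def)
qed

section \<open>Necessity in the two models\<close>

lemma transfer_necessary:
  assumes "transfer_feasible \<theta> \<alpha> \<beta>" "\<alpha>\<^sup>2 + \<beta>\<^sup>2 = 1"
  shows "\<alpha>\<^sup>2 * (cos \<theta>)\<^sup>2 \<le> 1 / 2"
proof -
  from assms obtain P where "restores_bell P 8 4 (ens (8 * 4) [diag_coeff 8 transfer_index (amp \<theta> \<alpha> \<beta>)])"
    by (auto simp: transfer_feasible_def initial_transfer_flat proj_flat [OF diag_coeff_carrier])
  then have "half_bounded (diag_coeff 8 transfer_index (amp \<theta> \<alpha> \<beta>))"
    by (rule restores_bell_half_bounded) simp_all
  then have "(cmod (amp \<theta> \<alpha> \<beta> 0))\<^sup>2 \<le> 1 / 2 * (\<Sum>i<4. (cmod (amp \<theta> \<alpha> \<beta> i))\<^sup>2)"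
    by (rule half_bounded_diag_coeffD) (simp_all add: transfer_index_less)
  then show ?thesis
    using assms(2) by (simp only: cmod_amp_sum) (simp add: cmod_amp mult.commute)
qed

lemma kraus_column_norm:
  assumes "kraus_complete m Ks" "c < m"
  shows "(\<Sum>K \<leftarrow> Ks. \<Sum>r<dim_row K. (cmod (K $$ (r, c)))\<^sup>2) = 1"
  using kraus_isometry [OF assms(1), of "\<lambda>i. if i = c then 1 else 0"] assms(2)
  by (simp add: if_distrib [of cmod] if_distrib [of "\<lambda>x. x\<^sup>2"] if_distrib [of "\<lambda>x. _ * x"] cong: if_cong)

text \<open>In each branch, level 0 gives \<alpha>^2 cos^2 \<theta> |M_k0|^2 \<le> (\<alpha>^2
  |M_k0|^2 + \<beta>^2 |M_k1|^2) / 2. Each column of the pooled Kraus operators has norm 1, so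
  summation leaves (\<alpha>^2 + \<beta>^2) / 2 on the right, whatever the number of
  messages.\<close>

lemma bank_necessary:
  assumes "bank_measures_feasible n \<theta> \<alpha> \<beta>" "\<alpha>\<^sup>2 + \<beta>\<^sup>2 = 1"
  shows "\<alpha>\<^sup>2 * (cos \<theta>)\<^sup>2 \<le> 1 / 2"
proof -
  from assms obtain I where I: "is_instr 2 I" and
    rest: "\<And>i. i < length I \<Longrightarrow> \<exists>P. restores_bell P 4 4 (after_bank \<theta> \<alpha> \<beta> I i)"
    by (auto simp: bank_measures_feasible_def)
  define Ks where "Ks = concat (map snd I)"
  have Ks: "kraus_complete 2 Ks" unfolding Ks_def by (rule instr_complete [OF I])
  have bound: "(\<alpha>\<^sup>2 * (cos \<theta>)\<^sup>2) * (cmod (M $$ (k, 0)))\<^sup>2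
      \<le> \<alpha>\<^sup>2 / 2 * (cmod (M $$ (k, 0)))\<^sup>2 + \<beta>\<^sup>2 / 2 * (cmod (M $$ (k, 1)))\<^sup>2"
    if M: "M \<in> set Ks" and k: "k < dim_row M" for M k
  proof -
    from M obtain i where i: "i < length I" "M \<in> set (kraus_ops I i)"
      unfolding Ks_def in_set_kraus_concat by auto
    have "M \<in> carrier_mat (out_dim I i) 2" using instr_carrier [OF I i(1)] i(2) by auto
    then have k': "k < out_dim I i" using k by simp
    define L where "L = concat (map (\<lambda>M. map (bank_branch \<theta> \<alpha> \<beta> M) [0..<out_dim I i]) (kraus_ops I i))"
    from rest [OF i(1)] obtain P where "restores_bell P 4 4 (ens (4 * 4) L)"
      unfolding after_bank_ens [OF I i(1)] L_def by blast
    moreover have "set L \<subseteq> carrier_mat 4 4" by (auto simp: L_def bank_branch_def)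
    moreover have "bank_branch \<theta> \<alpha> \<beta> M k \<in> set L"
      using i k' by (auto simp: L_def intro!: bexI [of _ M])
    ultimately have "half_bounded (bank_branch \<theta> \<alpha> \<beta> M k)"
      by (rule restores_bell_half_bounded)
    then have "(cmod (M $$ (k, 0 mod 2) * amp \<theta> \<alpha> \<beta> 0))\<^sup>2
        \<le> 1 / 2 * (\<Sum>l<4. (cmod (M $$ (k, l mod 2) * amp \<theta> \<alpha> \<beta> l))\<^sup>2)"
      unfolding bank_branch_def by (rule half_bounded_diag_coeffD) simp_all
    also have "(\<Sum>l<4. (cmod (M $$ (k, l mod 2) * amp \<theta> \<alpha> \<beta> l))\<^sup>2)
        = (\<alpha>\<^sup>2 * (cmod (M $$ (k, 0)))\<^sup>2 + \<beta>\<^sup>2 * (cmod (M $$ (k, 1)))\<^sup>2) * ((cos \<theta>)\<^sup>2 + (sin \<theta>)\<^sup>2)"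
      by (simp add: cmod_amp sum_lessThan_4 norm_mult power_mult_distrib algebra_simps
          del: sin_cos_squared_add sin_cos_squared_add2)
    finally show ?thesis
      by (simp add: cmod_amp norm_mult power_mult_distrib algebra_simps)
  qed
  have "(\<alpha>\<^sup>2 * (cos \<theta>)\<^sup>2) * (\<Sum>M \<leftarrow> Ks. \<Sum>k<dim_row M. (cmod (M $$ (k, 0)))\<^sup>2)
      = (\<Sum>M \<leftarrow> Ks. \<Sum>k<dim_row M. (\<alpha>\<^sup>2 * (cos \<theta>)\<^sup>2) * (cmod (M $$ (k, 0)))\<^sup>2)"
    by (simp only: sum_list_const_mult sum_distrib_left [symmetric])
  also have "\<dots> \<le> (\<Sum>M \<leftarrow> Ks. \<Sum>k<dim_row M.
      \<alpha>\<^sup>2 / 2 * (cmod (M $$ (k, 0)))\<^sup>2 + \<beta>\<^sup>2 / 2 * (cmod (M $$ (k, 1)))\<^sup>2)"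
    by (intro sum_list_mono sum_mono bound) simp_all
  also have "\<dots> = \<alpha>\<^sup>2 / 2 * (\<Sum>M \<leftarrow> Ks. \<Sum>k<dim_row M. (cmod (M $$ (k, 0)))\<^sup>2)
      + \<beta>\<^sup>2 / 2 * (\<Sum>M \<leftarrow> Ks. \<Sum>k<dim_row M. (cmod (M $$ (k, 1)))\<^sup>2)"
    by (simp only: sum.distrib sum_list_addf sum_list_const_mult sum_distrib_left [symmetric])
  finally show ?thesis
    using assms(2) by (simp add: kraus_column_norm [OF Ks] add_divide_distrib [symmetric])
qed

section \<open>Sufficiency in the two models\<close>

text \<open>The inequalities of \<open>diag_coeff_restorable\<close> are homogeneous in the squared
  moduli, so phases are free and \<open>t\<close> absorbs the branch probability: 1/2 for each
  outcome of the Bank, 1 for the transfer.\<close>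

lemma scaled_amp_restorable:
  assumes f: "inj_on f {..<4}" "\<And>i. i < 4 \<Longrightarrow> f i < d"
    and t: "0 < t" "\<And>i. i < 4 \<Longrightarrow> (cmod (a i))\<^sup>2 = t * (cmod (amp \<theta> \<alpha> \<beta> i))\<^sup>2"
    and \<theta>: "0 < \<theta>" "\<theta> \<le> pi / 4" and \<alpha>\<beta>: "\<alpha> \<ge> \<beta>" "\<beta> > 0" "\<alpha>\<^sup>2 + \<beta>\<^sup>2 = 1"
    and le: "\<alpha>\<^sup>2 * (cos \<theta>)\<^sup>2 \<le> 1 / 2"
  shows "\<exists>P. restores_bell P d 4 (ens (d * 4) [diag_coeff d f a])"
proof -
  define C S where "C = (cos \<theta>)\<^sup>2" and "S = (sin \<theta>)\<^sup>2"
  have sc: "C + S = 1" by (simp add: C_def S_def)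
  have "0 < sin \<theta>" using \<theta> by (intro sin_gt_zero) simp_all
  moreover have "sin \<theta> \<le> cos \<theta>"
  proof -
    have "sin \<theta> \<le> sin (pi / 4)" using \<theta> by (intro sin_monotone_2pi_le) simp_all
    also have "\<dots> = cos (pi / 4)" by (simp add: sin_45 cos_45)
    also have "\<dots> \<le> cos \<theta>" using \<theta> by (intro cos_monotone_0_pi_le) simp_all
    finally show ?thesis .
  qed
  ultimately have pos: "0 < S" "0 < C" and SC: "S \<le> C"
    by (auto simp: S_def C_def intro: power_mono)
  have ab: "\<beta>\<^sup>2 \<le> \<alpha>\<^sup>2" "0 < \<beta>\<^sup>2" "0 < \<alpha>\<^sup>2" using \<alpha>\<beta> by (auto intro: power_mono)
  have amp: "(cmod (amp \<theta> \<alpha> \<beta> 0))\<^sup>2 = \<alpha>\<^sup>2 * C" "(cmod (amp \<theta> \<alpha> \<beta> 1))\<^sup>2 = \<beta>\<^sup>2 * C"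
    "(cmod (amp \<theta> \<alpha> \<beta> 2))\<^sup>2 = \<alpha>\<^sup>2 * S" "(cmod (amp \<theta> \<alpha> \<beta> 3))\<^sup>2 = \<beta>\<^sup>2 * S"
    by (simp_all add: cmod_amp C_def S_def)
  note a = t(2) [of 0] t(2) [of 1] t(2) [of 2] t(2) [of 3]
  have e: "S = 1 - C" "\<beta>\<^sup>2 = 1 - \<alpha>\<^sup>2" using sc \<alpha>\<beta>(3) by simp_all
  show ?thesis
  proof (rule diag_coeff_restorable [OF f])
    fix i :: nat assume "i < 4"
    then have "i = 0 \<or> i = 1 \<or> i = 2 \<or> i = 3" by auto
    then have "0 < (cmod (a i))\<^sup>2"
      using a amp pos ab t(1) by (elim disjE) simp_all
    then show "a i \<noteq> 0" by auto
  next
    \<comment> \<open>The squared amplitudes add up to 1, so this says 2 \<alpha>^2 \<open>C\<close>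
      \<le> 1.\<close>
    have "\<alpha>\<^sup>2 * C \<le> \<beta>\<^sup>2 * C + \<alpha>\<^sup>2 * S + \<beta>\<^sup>2 * S"
      using le unfolding C_def [symmetric] e by (simp add: algebra_simps)
    from mult_left_mono [OF this, of t]
    show "(cmod (a 0))\<^sup>2 \<le> (cmod (a 1))\<^sup>2 + (cmod (a 2))\<^sup>2 + (cmod (a 3))\<^sup>2"
      using t(1) a amp by (simp add: distrib_left)
  next
    \<comment> \<open>Term by term, from \<beta> \<le> \<alpha>.\<close>
    have "\<beta>\<^sup>2 * C + \<beta>\<^sup>2 * S \<le> \<alpha>\<^sup>2 * C + \<alpha>\<^sup>2 * S"
      using ab pos by (intro add_mono mult_right_mono) simp_all
    from mult_left_mono [OF this, of t]
    show "(cmod (a 1))\<^sup>2 + (cmod (a 3))\<^sup>2 \<le> (cmod (a 0))\<^sup>2 + (cmod (a 2))\<^sup>2"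
      using t(1) a amp by (simp add: distrib_left)
  next
    \<comment> \<open>Term by term, from \<open>S \<le> C\<close>, which expresses \<theta> \<le>
      \<open>pi / 4\<close>.\<close>
    have "\<alpha>\<^sup>2 * S + \<beta>\<^sup>2 * S \<le> \<alpha>\<^sup>2 * C + \<beta>\<^sup>2 * C"
      using ab SC by (intro add_mono mult_left_mono) simp_all
    from mult_left_mono [OF this, of t]
    show "(cmod (a 2))\<^sup>2 + (cmod (a 3))\<^sup>2 \<le> (cmod (a 0))\<^sup>2 + (cmod (a 1))\<^sup>2"
      using t(1) a amp by (simp add: distrib_left)
  qed
qed

text \<open>The two Kraus operators are the rows of the Hadamard matrix, with output dimension 1:
  the Bank retains nothing.\<close>

lemma hadamard_instr:
  defines "h \<equiv> complex_of_real (1 / sqrt 2)"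
  shows "is_instr 2 [(1, [mat 1 2 (\<lambda>_. h)]), (1, [mat 1 2 (\<lambda>(r, c). if c = 0 then h else - h)])]"
proof -
  have "h * h = of_real (1 / sqrt 2 * (1 / sqrt 2))" by (simp only: h_def of_real_mult)
  then have h: "h * h = 1 / 2" "cnj h = h" by (simp_all add: h_def)
  show ?thesis
    unfolding is_instr_def
    by (auto intro!: eq_matI simp: adjoint_eq scalar_prod_def h less_2_cases_iff)
qed

lemma bank_sufficient:
  assumes \<theta>: "0 < \<theta>" "\<theta> \<le> pi / 4" and \<alpha>\<beta>: "\<alpha> \<ge> \<beta>" "\<beta> > 0" "\<alpha>\<^sup>2 + \<beta>\<^sup>2 = 1"
    and le: "\<alpha>\<^sup>2 * (cos \<theta>)\<^sup>2 \<le> 1 / 2"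
  shows "bank_measures_feasible 2 \<theta> \<alpha> \<beta>"
proof -
  define h where "h = complex_of_real (1 / sqrt 2)"
  define I :: instr where
    "I = [(1, [mat 1 2 (\<lambda>_. h)]), (1, [mat 1 2 (\<lambda>(r, c). if c = 0 then h else - h)])]"
  have I: "is_instr 2 I" unfolding I_def h_def by (rule hadamard_instr)
  have "\<exists>P. restores_bell P 4 4 (after_bank \<theta> \<alpha> \<beta> I i)" if "i < 2" for i
  proof -
    have i: "i < length I" using that by (simp add: I_def)
    from that have "i = 0 \<or> i = 1" by auto
    \<comment> \<open>Both outcomes are handled together, as only the moduli of the entries of
      \<open>M\<close> matter.\<close>
    then obtain M where M: "out_dim I i = 1" "kraus_ops I i = [M]" "\<And>c. c < 2 \<Longrightarrow> M $$ (0, c) = h \<or> M $$ (0, c) = - h"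
      by (auto simp: I_def out_dim_def kraus_ops_def)
    have "(cmod (M $$ (0, l mod 2) * amp \<theta> \<alpha> \<beta> l))\<^sup>2 = 1 / 2 * (cmod (amp \<theta> \<alpha> \<beta> l))\<^sup>2" for l
      using M(3) [of "l mod 2"] by (auto simp: h_def norm_mult norm_divide power_mult_distrib power_divide)
    then have "\<exists>P. restores_bell P 4 4 (ens (4 * 4) [bank_branch \<theta> \<alpha> \<beta> M 0])"
      unfolding bank_branch_def
      by (intro scaled_amp_restorable [where t = "1 / 2", OF _ _ _ _ \<theta> \<alpha>\<beta> le]) simp_all
    then show ?thesis by (simp add: after_bank_ens [OF I i] M)
  qed
  then show ?thesis
    unfolding bank_measures_feasible_def using I by (intro exI [of _ I]) (simp add: I_def)
qed

lemma transfer_sufficient: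
  assumes \<theta>: "0 < \<theta>" "\<theta> \<le> pi / 4" and \<alpha>\<beta>: "\<alpha> \<ge> \<beta>" "\<beta> > 0" "\<alpha>\<^sup>2 + \<beta>\<^sup>2 = 1"
    and le: "\<alpha>\<^sup>2 * (cos \<theta>)\<^sup>2 \<le> 1 / 2"
  shows "transfer_feasible \<theta> \<alpha> \<beta>"
  unfolding transfer_feasible_def initial_transfer_flat proj_flat [OF diag_coeff_carrier]
  by (rule scaled_amp_restorable [where t = 1, OF inj_transfer_index transfer_index_less _ _ \<theta> \<alpha>\<beta> le]) simp_all

theorem theorem3:
  fixes \<theta> \<alpha> \<beta> :: real
  assumes "0 < \<theta>" and "\<theta> \<le> pi / 4"
    and "\<alpha> \<ge> \<beta>" and "\<beta> > 0" and "\<alpha>\<^sup>2 + \<beta>\<^sup>2 = 1"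
  shows "(bank_measures_feasible 2 \<theta> \<alpha> \<beta> \<longleftrightarrow> \<alpha>\<^sup>2 \<le> 1 / (2 * (cos \<theta>)\<^sup>2)) \<and>
         (transfer_feasible \<theta> \<alpha> \<beta> \<longleftrightarrow> \<alpha>\<^sup>2 \<le> 1 / (2 * (cos \<theta>)\<^sup>2))"
proof -
  have "0 < cos \<theta>" using assms(1,2) by (intro cos_gt_zero_pi) simp_all
  then have "\<alpha>\<^sup>2 \<le> 1 / (2 * (cos \<theta>)\<^sup>2) \<longleftrightarrow> \<alpha>\<^sup>2 * (cos \<theta>)\<^sup>2 \<le> 1 / 2"
    by (simp add: field_simps)
  then show ?thesis
    using bank_necessary transfer_necessary assms(5)
      bank_sufficient [OF assms] transfer_sufficient [OF assms] by blast
qed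

end
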